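(* The following assertions hold: (a) The family of sets $\mathfrak{R}=\{\mathfrak{R}_\alpha\}_{\alpha\in[0,1]}$ is a strict filtration of $\mathcal{G}_0$. (b) Let $f_\alpha$, $\alpha\in(0,1]$, be defined by $f_\alpha(z)=z+\frac{1}{2(2-\alpha)}z^2$. Then $f_\alpha\in\partial\mathfrak{R}_\alpha$. (c) $K(\mathfrak{R}_\alpha)=\frac12$ and $B(\mathfrak{R}_\alpha)=1$ for any $\alpha\in[0,1]$.
   Context: Let $\mathbb{D}$ be the open unit disk. $\mathcal{A}$ is the set of holomorphic $f:\mathbb{D}\to\mathbb{C}$ with $f(0)=0$, $f'(0)=1$; quotients $f(z)/z$ are extended by their limit at $0$. $\mathcal{G}_0=\{f\in\mathcal{A}:\operatorname{Re}(f(z)/z)>0,\ z\in\mathbb{D}\}$. For $0\le\alpha<1$, $\mathcal{S}^*(\alpha)=\{f\in\mathcal{A}:\operatorname{Re}\frac{zf'(z)}{f(z)}\ge\alpha,\ z\in\mathbb{D}\}$. For $f=\sum a_nz^n$, $g=\sum b_nz^n$, the Hadamard product is $f*g=\sum a_nb_nz^n$. For $\alpha\in[0,1)$, $\mathfrak{R}_\alpha$ (prestarlike functions of order $\alpha$) is the set of $f\in\mathcal{A}$ with $f(z)*\frac{z}{(1-z)^{2-2\alpha}}\in\mathcal{S}^*(\alpha)$; and $\mathfrak{R}_1=\{f\in\mathcal{A}:\operatorname{Re}\frac{f(z)}{z}>\frac12,\ z\in\mathbb{D}\setminus\{0\}\}$. A filtration of $\mathcal{G}_0$ (indexed by a connected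 $J\subset\mathbb{R}$) is a family $\{\mathfrak{F}_s\}_{s\in J}$ of subsets of $\mathcal{G}_0$ with $\mathfrak{F}_s\subseteq\mathfrak{F}_t$ for $s\le t$. It is strict if $\mathfrak{F}_s\subsetneq\mathfrak{F}_t$ for $s<t$. The boundary is $\partial\mathfrak{F}_t=\mathfrak{F}_t\setminus\bigcup_{s\in J,\,s<t}\mathfrak{F}_s$. For $\mathcal{G}_1\subseteq\mathcal{G}_0$: $K(\mathcal{G}_1)=\inf_{f\in\mathcal{G}_1}\inf_{z\in\mathbb{D}}\operatorname{Re}\frac{f(z)}{z}$, $B(\mathcal{G}_1)=\frac2\pi\sup_{f\in\mathcal{G}_1}\sup_{z\in\mathbb{D}}\left|\arg\frac{f(z)}{z}\right|$ (principal argument). *)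

theory Defs
  imports "HOL-Complex_Analysis.Complex_Analysis"
begin

text \<open>Functions on the open unit disc are represented by total functions on \<^typ>\<open>complex\<close>.
  Membership in every class below depends only on the values on \<^term>\<open>ball (0::complex) 1\<close>.\<close>

definition class_A :: "(complex \<Rightarrow> complex) set" where
  "class_A = {f. f holomorphic_on ball 0 1 \<and> f 0 = 0 \<and> deriv f 0 = 1}"

text \<open>A function on the punctured disc, extended to the origin by its limit there.\<close>

definition ext0 :: "(complex \<Rightarrow> complex) \<Rightarrow> complex \<Rightarrow> complex" where
  "ext0 q = (\<lambda>z. if z = 0 then Lim (at 0) q else q z)"

definition quot_z :: "(complex \<Rightarrow> complex) \<Rightarrow> complex \<Rightarrow> complex" where
  "quot_z f = ext0 (\<lambda>z. f z / z)"

definition class_G0 :: "(complex \<Rightarrow> complex) set" where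
  "class_G0 = {f \<in> class_A. \<forall>z\<in>ball 0 1. Re (quot_z f z) > 0}"

text \<open>The inequality presupposes that \<open>z f'(z) / f(z)\<close> is defined away from the origin. Since
  division by zero yields zero in HOL, this is made explicit by \<open>f z \<noteq> 0\<close>.\<close>

definition starlike_order :: "real \<Rightarrow> (complex \<Rightarrow> complex) set" where
  "starlike_order \<alpha> = {f \<in> class_A. (\<forall>z\<in>ball 0 1 - {0}. f z \<noteq> 0) \<and>
     (\<forall>z\<in>ball 0 1. Re (ext0 (\<lambda>w. w * deriv f w / f w) z) \<ge> \<alpha>)}"

definition hadamard :: "(complex \<Rightarrow> complex) \<Rightarrow> (complex \<Rightarrow> complex) \<Rightarrow> complex \<Rightarrow> complex" where
  "hadamard f g = eval_fps (Abs_fps (\<lambda>n.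
     fps_nth (fps_expansion f 0) n * fps_nth (fps_expansion g 0) n))"

text \<open>Only \<open>\<alpha> \<in> {0..1}\<close> is meaningful. The power is the principal branch, which is holomorphic on
  the disc because \<open>1 - z\<close> stays in the right half-plane.\<close>

definition prestarlike :: "real \<Rightarrow> (complex \<Rightarrow> complex) set" where
  "prestarlike \<alpha> =
     (if \<alpha> = 1 then {f \<in> class_A. \<forall>z\<in>ball 0 1 - {0}. Re (f z / z) > 1 / 2}
      else {f \<in> class_A.
        hadamard f (\<lambda>z. z / (1 - z) powr of_real (2 - 2 * \<alpha>)) \<in> starlike_order \<alpha>})"

definition filtration :: "real set \<Rightarrow> (real \<Rightarrow> (complex \<Rightarrow> complex) set) \<Rightarrow> bool" where
  "filtration J F \<longleftrightarrow> connected J \<and> (\<forall>s\<in>J. F s \<subseteq> class_G0) \<and>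
     (\<forall>s\<in>J. \<forall>t\<in>J. s \<le> t \<longrightarrow> F s \<subseteq> F t)"

definition strict_filtration :: "real set \<Rightarrow> (real \<Rightarrow> (complex \<Rightarrow> complex) set) \<Rightarrow> bool" where
  "strict_filtration J F \<longleftrightarrow> filtration J F \<and> (\<forall>s\<in>J. \<forall>t\<in>J. s < t \<longrightarrow> F s \<subset> F t)"

definition filtration_boundary ::
    "real set \<Rightarrow> (real \<Rightarrow> (complex \<Rightarrow> complex) set) \<Rightarrow> real \<Rightarrow> (complex \<Rightarrow> complex) set" where
  "filtration_boundary J F t = F t - (\<Union>s\<in>{s\<in>J. s < t}. F s)"

text \<open>For a nonempty subset \<open>G\<close> of \<^const>\<open>class_G0\<close>, all infima and suprema below are over
  nonempty sets of reals bounded in the relevant direction: real parts are positive, and arguments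
  are at most \<open>\<pi>/2\<close> in absolute value.\<close>

definition K_const :: "(complex \<Rightarrow> complex) set \<Rightarrow> real" where
  "K_const G = (INF f\<in>G. INF z\<in>ball 0 1. Re (quot_z f z))"

definition B_const :: "(complex \<Rightarrow> complex) set \<Rightarrow> real" where
  "B_const G = 2 / pi * (SUP f\<in>G. SUP z\<in>ball 0 1. \<bar>Arg (quot_z f z)\<bar>)"

end

(* Write f(z)/z = sum e_n z^n and H_c(z) = sum (c)_n/n! e_n z^n. For alpha < 1 and a = 2 - 2 alpha,
   f lies in R_alpha iff H_a has no zeros and Re (z H_a'/H_a) >= -a/2 on the disc, and f lies in R_1
   iff Re H_1 > 1/2. So the inclusion R_alpha <= R_beta is a statement about passing from H_a to H_b
   with 0 <= b <= a, and one may assume s = a - b <= 1.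
   By Herglotz, H_a is a limit of products prod (1 - y_k z)^(-c_k) with sum c_k = a. Rescale to
   z_0 = 1, where |y_k| < 1, and put v_k = 1/(1 - y_k), so Re v_k > 1/2; Feynman's formula then shows
   that H_a/H_a(1) is a mixture of the functions (v + (1 - v) z)^(-a), v in the convex hull of the v_k.
   The multipliers taking H_a to H_b and H_(b+1) send such a function to functions whose values at 1
   are v^(-s) and v^(1-s). Since b H_(b+1) = z H_b' + b H_b, the bound Re (z H_b'/H_b) >= -b/2 says
   Re ((2 H_(b+1) - H_b) cnj H_b) >= 0, and by bilinearity this follows from
   Re ((v + cnj w - 1) v^(-s) (cnj w)^(-s)) >= 0 for Re v, Re w >= 1/2 and 0 <= s <= 1. The argument of
   the left-hand side is affine in s, so it is enough to look at s = 0 and s = 1. *)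

theory Submission
  imports Defs
begin

section \<open>Power kernels and Beta integrals\<close>

text \<open>The class R_1 has a definition of its own; it is reached at b = 0. There H_0 is
  identically 1 and its logarithmic derivative says nothing, but Re ((2 H_1 - H_0) cnj H_0) >= 0
  still reads Re H_1 >= 1/2. Hence this Hermitian form, rather than the logarithmic derivative, is
  the quantity estimated for all b >= 0. It ignores unimodular factors, so the mixture has to be
  known only up to a phase, and positive factors are absorbed by working with cones. No limit
  measure is constructed. With z_0 fixed and |z_0| < r < 1, the density on the circle of radius r is
  cut into finitely many masses, and only Taylor coefficients pass to a limit. The nodes satisfy
  |y_k| = |z_0|/r < 1, which keeps the v_k in a compact convex set and makes all series at 1
  converge uniformly. The form does not exclude zeros of H_b; a second positive functional gives Re
  (H_b/H_a) >= 0, and the minimum principle does the rest. Sharpness rests on two examples: z/(1 -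
  z), which lies in every class, and f_alpha, which also shows strictness.\<close>

lemma Re_powr_kernel_nonneg:
  fixes A B :: complex and s :: real
  assumes A: "Re A \<ge> 1/2" and B: "Re B \<ge> 1/2" and s: "0 \<le> s" "s \<le> 1"
  shows "Re ((A + B - 1) * A powr (- of_real s) * B powr (- of_real s)) \<ge> 0"
proof (cases "A + B - 1 = 0")
  case False
  define C where "C = A + B - 1"
  have nz: "A \<noteq> 0" "B \<noteq> 0" "C \<noteq> 0" using A B False by (auto simp: C_def)
  have ReC: "Re C \<ge> 0" using A B by (simp add: C_def)
  define \<theta> where "\<theta> = Im (Ln C)"
  define \<gamma> where "\<gamma> = Im (Ln A) + Im (Ln B)"
  have bA: "\<bar>Im (Ln A)\<bar> < pi/2" and bB: "\<bar>Im (Ln B)\<bar> < pi/2"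
    using A B Re_Ln_pos_lt_imp[of A] Re_Ln_pos_lt_imp[of B] by auto
  have bC: "\<bar>\<theta>\<bar> \<le> pi/2" unfolding \<theta>_def using ReC nz(3) by (subst Re_Ln_pos_le)
  have rep: "Re (C * A powr (- of_real t) * B powr (- of_real t))
      = exp (Re (Ln C) - t * Re (Ln A) - t * Re (Ln B)) * cos (\<theta> - t * \<gamma>)" for t :: real
  proof -
    have "C * A powr (- of_real t) * B powr (- of_real t)
        = exp (Ln C - of_real t * Ln A - of_real t * Ln B)"
      using nz by (simp add: powr_def exp_diff exp_minus divide_inverse)
    thus ?thesis by (simp add: Re_exp \<theta>_def \<gamma>_def algebra_simps)
  qed
  \<comment> \<open>At s = 1 the product is 1 - (1 - 1/A) (1 - 1/B). Since Re Z >= 1/2 means that Z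
    is at least as close to 1 as to 0, both factors lie in the closed unit disc.\<close>
  have "C * A powr (- of_real 1) * B powr (- of_real 1) = 1 - (1 - 1/A) * (1 - 1/B)"
    using nz by (simp add: powr_minus C_def field_simps)
  moreover have "norm ((1 - 1/A) * (1 - 1/B)) \<le> 1"
  proof -
    have "norm (1 - 1/Z) \<le> 1" if "Re Z \<ge> 1/2" for Z :: complex
    proof -
      have "(norm (Z - 1))\<^sup>2 = (norm Z)\<^sup>2 - 2 * Re Z + 1"
        unfolding cmod_power2 by (simp add: power2_eq_square algebra_simps)
      hence "(norm (Z - 1))\<^sup>2 \<le> (norm Z)\<^sup>2" using that by linarith
      hence "norm (Z - 1) \<le> norm Z" by (rule power2_le_imp_le) simp
      moreover have "Z \<noteq> 0" using that by auto
      ultimately show ?thesis by (simp add: norm_divide diff_divide_eq_iff)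
    qed
    thus ?thesis using A B by (simp add: norm_mult mult_le_one)
  qed
  ultimately have "Re (C * A powr (- of_real 1) * B powr (- of_real 1)) \<ge> 0"
    using complex_Re_le_cmod[of "(1 - 1/A) * (1 - 1/B)"] by simp
  hence "0 \<le> exp (Re (Ln C) - 1 * Re (Ln A) - 1 * Re (Ln B)) * cos (\<theta> - 1 * \<gamma>)"
    by (simp only: rep)
  \<comment> \<open>The sign of the cosine locates the angle only modulo 2 pi; the bound 3 pi / 2,
    from |\<theta>| <= pi/2 and |\<gamma>| < pi, leaves only the interval around 0.\<close>
  hence "cos (\<theta> - \<gamma>) \<ge> 0" by (simp add: zero_le_mult_iff)
  moreover have "\<bar>\<theta> - \<gamma>\<bar> < 3 * pi / 2" using bA bB bC unfolding \<gamma>_def by linarith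
  ultimately have "\<bar>\<theta> - \<gamma>\<bar> \<le> pi / 2"
  proof -
    define u where "u = \<bar>\<theta> - \<gamma>\<bar>"
    have u: "0 \<le> u" "u < 3 * pi/2" "cos u \<ge> 0"
      using \<open>cos (\<theta> - \<gamma>) \<ge> 0\<close> \<open>\<bar>\<theta> - \<gamma>\<bar> < 3 * pi / 2\<close> by (simp_all add: u_def)
    have "u \<le> pi/2"
    proof (rule ccontr)
      assume "\<not> u \<le> pi/2"
      hence "cos (u - pi) > 0" using u by (intro cos_gt_zero_pi) auto
      thus False using u by (simp add: cos_diff)
    qed
    thus ?thesis by (simp add: u_def)
  qed
  moreover have "\<theta> - s * \<gamma> = (1 - s) * \<theta> + s * (\<theta> - \<gamma>)" by (simp add: algebra_simps)
  moreover have "\<bar>(1 - s) * \<theta> + s * (\<theta> - \<gamma>)\<bar> \<le> (1 - s) * (pi/2) + s * (pi/2)"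
  proof -
    have "\<bar>(1 - s) * \<theta> + s * (\<theta> - \<gamma>)\<bar> \<le> (1 - s) * \<bar>\<theta>\<bar> + s * \<bar>\<theta> - \<gamma>\<bar>"
      using s by (intro order_trans[OF abs_triangle_ineq]) (simp add: abs_mult)
    also have "\<dots> \<le> (1 - s) * (pi/2) + s * (pi/2)"
      using s bC \<open>\<bar>\<theta> - \<gamma>\<bar> \<le> pi / 2\<close> by (intro add_mono mult_left_mono) auto
    finally show ?thesis .
  qed
  moreover have "(1 - s) * (pi/2) + s * (pi/2) = pi/2" by (simp only: left_diff_distrib)
  ultimately have "\<bar>\<theta> - s * \<gamma>\<bar> \<le> pi/2" by (simp only:)
  hence "cos (\<theta> - s * \<gamma>) \<ge> 0" by (intro cos_ge_zero; linarith)
  thus ?thesis using rep[of s] by (simp add: C_def)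
qed simp

text \<open>These are the Taylor coefficients of (1 - z)^(-c), so multiplying coefficients by
  \<open>binc c\<close> is the Hadamard product with this function.\<close>

definition binc :: "real \<Rightarrow> nat \<Rightarrow> real" where
  "binc c n = pochhammer c n / fact n"

lemma binc_nonneg: "c \<ge> 0 \<Longrightarrow> binc c n \<ge> 0"
  by (auto simp: binc_def pochhammer_prod intro!: divide_nonneg_pos prod_nonneg)

lemma binc_0 [simp]: "binc c 0 = 1" by (simp add: binc_def)

lemma binc_sums:
  fixes x :: complex
  assumes "norm x < 1"
  shows "(\<lambda>n. of_real (binc c n) * x ^ n) sums (1 - x) powr (- of_real c)"
proof -
  have "((- of_real c :: complex) gchoose n) * (- x) ^ n = of_real (binc c n) * x ^ n" for n
  proof -
    have "((- of_real c :: complex) gchoose n) * (- x) ^ n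
        = ((-1) ^ n * (-1) ^ n) * (pochhammer (of_real c) n / fact n * x ^ n)"
      by (simp only: gbinomial_pochhammer power_minus[of x] minus_minus) (simp only: mult_ac times_divide_eq_left times_divide_eq_right)
    also have "(-1 :: complex) ^ n * (-1) ^ n = 1" by (simp flip: power_mult_distrib)
    finally show ?thesis by (simp add: binc_def pochhammer_of_real)
  qed
  with gen_binomial_complex[of "-x" "- of_real c"] assms show ?thesis by simp
qed

lemma binc_summable:
  assumes "0 \<le> x" "x < 1"
  shows "summable (\<lambda>n. binc c n * x ^ n)"
proof -
  have "summable (\<lambda>n. complex_of_real (binc c n * x ^ n))"
    using binc_sums[of "of_real x" c] assms by (simp add: sums_iff)
  thus ?thesis by (simp only: summable_complex_of_real)
qed

section \<open>Beta integrals and Feynman's formula\<close>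

lemma Beta_add_nat:
  fixes p q :: real
  assumes "p > 0" "q > 0"
  shows "Beta (p + real j) (q + real m) = Beta p q * pochhammer p j * pochhammer q m / pochhammer (p + q) (j + m)"
proof -
  have np: "x \<notin> \<int>\<^sub>\<le>\<^sub>0" if "x > 0" for x :: real using that by (auto elim!: nonpos_Ints_cases)
  have G: "Gamma (x + real n) = pochhammer x n * Gamma x" if "x > 0" for x n
    using pochhammer_Gamma[OF np[OF that], of n] Gamma_real_pos[OF that] by simp
  have "Gamma (p + real j + (q + real m)) = pochhammer (p + q) (j + m) * Gamma (p + q)"
    using G[of "p + q" "j + m"] assms by (simp add: algebra_simps)
  thus ?thesis using G[of p j] G[of q m] assms
    by (simp add: Beta_def mult_ac)
qed

text \<open>Integrating the binomial expansion of (t x + (1 - t) y)^n against the Beta weight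
  produces the left side; the identity turns each term into one of the Cauchy product of the
  binomial series with exponents p and q.\<close>

lemma binc_Beta:
  assumes pq: "p > 0" "q > 0" and "j \<le> n"
  shows "binc (p + q) n * real (n choose j) * Beta (p + real j) (q + real (n - j))
       = Beta p q * (binc p j * binc q (n - j))"
proof -
  have "pochhammer (p + q) n \<noteq> 0" using pochhammer_pos[of "p + q" n] pq by simp
  thus ?thesis unfolding Beta_add_nat[OF pq] using assms(3)
    by (simp add: binc_def binomial_fact field_simps)
qed

text \<open>\<open>K\<close> and \<open>J\<close> stay abstract because there are two uses:
  \<open>K = 1\<close> leads to Feynman's formula, and a power of the mixture of two points extends
  it to all Taylor coefficients of a product of kernels.\<close>

lemma Beta_integral_binomial:
  fixes x y :: complex and p q :: real
  assumes pq: "p > 0" "q > 0"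
    and K: "\<And>j. j \<le> n \<Longrightarrow> ((\<lambda>t. of_real (t powr (p + real j - 1) * (1 - t) powr (q + real (n - j) - 1)) * K t)
              has_integral of_real (Beta (p + real j) (q + real (n - j))) * J j) {0..1}"
  shows "((\<lambda>t. of_real (t powr (p - 1) * (1 - t) powr (q - 1)) *
            (of_real (binc (p + q) n) * (of_real t * x + of_real (1 - t) * y) ^ n * K t)) has_integral
          of_real (Beta p q) * (\<Sum>j\<le>n. of_real (binc p j) * x ^ j * (of_real (binc q (n - j)) * y ^ (n - j)) * J j)) {0..1}"
    (is "(?f has_integral ?I) _")
proof -
  let ?g = "\<lambda>t. \<Sum>j\<le>n. of_real (t powr (p + real j - 1) * (1 - t) powr (q + real (n - j) - 1)) * K t *
            (of_real (binc (p + q) n * real (n choose j)) * (x ^ j * y ^ (n - j)))"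
  have "(?g has_integral (\<Sum>j\<le>n. of_real (Beta (p + real j) (q + real (n - j))) * J j *
            (of_real (binc (p + q) n * real (n choose j)) * (x ^ j * y ^ (n - j))))) {0..1}"
    by (intro has_integral_sum has_integral_mult_left K) auto
  also have "(\<Sum>j\<le>n. of_real (Beta (p + real j) (q + real (n - j))) * J j *
            (of_real (binc (p + q) n * real (n choose j)) * (x ^ j * y ^ (n - j)))) = ?I"
    unfolding sum_distrib_left
  proof (intro sum.cong refl)
    fix j assume "j \<in> {..n}"
    hence "j \<le> n" by simp
    have "of_real (Beta (p + real j) (q + real (n - j))) * J j *
            (of_real (binc (p + q) n * real (n choose j)) * (x ^ j * y ^ (n - j)))
        = of_real (binc (p + q) n * real (n choose j) * Beta (p + real j) (q + real (n - j)))
            * (J j * (x ^ j * y ^ (n - j)))"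
      by (simp add: mult_ac)
    also have "\<dots> = of_real (Beta p q) * (of_real (binc p j) * x ^ j * (of_real (binc q (n - j)) * y ^ (n - j)) * J j)"
      unfolding binc_Beta[OF pq \<open>j \<le> n\<close>] by (simp add: mult_ac)
    finally show "of_real (Beta (p + real j) (q + real (n - j))) * J j *
            (of_real (binc (p + q) n * real (n choose j)) * (x ^ j * y ^ (n - j)))
        = of_real (Beta p q) * (of_real (binc p j) * x ^ j * (of_real (binc q (n - j)) * y ^ (n - j)) * J j)" .
  qed
  finally have I: "(?g has_integral ?I) (cbox 0 1)" by simp
  have "(?f has_integral ?I) (cbox 0 1)"
  proof (rule has_integral_spike_interior[OF I])
    fix t :: real assume "t \<in> box 0 1"
    hence t: "0 < t" "t < 1" by auto
    have pw: "t powr (p + real j - 1) = t powr (p - 1) * t ^ j"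
             "(1 - t) powr (q + real k - 1) = (1 - t) powr (q - 1) * (1 - t) ^ k" for j k
      using t by (simp_all add: powr_realpow[symmetric] powr_add[symmetric] algebra_simps)
    show "?f t = ?g t"
      unfolding binomial_ring sum_distrib_left sum_distrib_right pw
      by (intro sum.cong refl) (simp add: power_mult_distrib mult_ac)
  qed
  thus ?thesis by simp
qed

lemma Beta_weight_integrable:
  fixes p q :: real
  assumes "p > 0" "q > 0"
  shows "(\<lambda>t. t powr (p - 1) * (1 - t) powr (q - 1)) integrable_on {0..1}"
  using has_integral_Beta_real[of p q] assms by (auto simp: has_integral_integrable)

text \<open>Feynman's formula. Expanding around a large positive real number makes both binomial series
  converge at once, although \<open>A\<close> and \<open>B\<close> need not be close to each other.\<close>

lemma Feynman_has_integral:
  fixes A B :: complex and p q :: real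
  assumes A: "Re A > 0" and B: "Re B > 0" and pq: "p > 0" "q > 0"
  shows "((\<lambda>t. of_real (t powr (p - 1) * (1 - t) powr (q - 1)) *
            (of_real t * A + of_real (1 - t) * B) powr (- of_real (p + q))) has_integral
          of_real (Beta p q) * (A powr (- of_real p) * B powr (- of_real q))) {0..1}"
proof -
  \<comment> \<open>|1 - Z/M| < 1 holds as soon as |Z|^2 < 2 M Re Z, which |Z|^2 / Re Z <= M
    guarantees with a factor 2 to spare. The sum of the two quotients serves \<open>A\<close> and
    \<open>B\<close> together.\<close>
  define M where "M = (norm A)\<^sup>2 / Re A + (norm B)\<^sup>2 / Re B"
  have M0: "M > 0" using A B by (auto simp: M_def intro!: add_pos_pos divide_pos_pos)
  have far: "norm (1 - Z / of_real M) < 1" if "Re Z > 0" "(norm Z)\<^sup>2 / Re Z \<le> M" for Z :: complex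
  proof -
    have "(norm Z)\<^sup>2 \<le> M * Re Z" using that by (simp add: field_simps)
    moreover have "M * Re Z > 0" using M0 that by simp
    moreover have "(norm (of_real M - Z))\<^sup>2 = M\<^sup>2 - 2 * (M * Re Z) + (norm Z)\<^sup>2"
      unfolding cmod_power2 by (simp add: power2_eq_square algebra_simps)
    ultimately have "(norm (of_real M - Z))\<^sup>2 < M\<^sup>2" by linarith
    hence "norm (of_real M - Z) < M" using M0 by (intro power2_less_imp_less[of _ M]) auto
    moreover have "1 - Z / of_real M = (of_real M - Z) / of_real M"
      using M0 by (simp add: diff_divide_distrib)
    hence "norm (1 - Z / of_real M) = norm (of_real M - Z) / M"
      using M0 by (simp add: norm_divide)
    ultimately show ?thesis using M0 by simp
  qed
  define x where "x = 1 - A / of_real M"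
  define y where "y = 1 - B / of_real M"
  define r where "r = max (norm x) (norm y)"
  have "(norm A)\<^sup>2 / Re A \<le> M" "(norm B)\<^sup>2 / Re B \<le> M"
    unfolding M_def using A B by simp_all
  hence xy: "norm x < 1" "norm y < 1" unfolding x_def y_def using A B far by blast+
  have r: "0 \<le> r" "r < 1" using xy by (simp_all add: r_def le_max_iff_disj)
  have AM: "A = of_real M * (1 - x)" "B = of_real M * (1 - y)"
    using M0 by (simp_all add: x_def y_def)
  define W where "W = (\<lambda>t::real. t powr (p - 1) * (1 - t) powr (q - 1))"
  define u where "u = (\<lambda>t::real. of_real t * x + of_real (1 - t) * y)"
  have u: "norm (u t) \<le> r" if "t \<in> {0..1}" for t
  proof -
    have "norm (u t) \<le> t * norm x + (1 - t) * norm y"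
      unfolding u_def using that by (intro order_trans[OF norm_triangle_ineq]) (simp add: norm_mult flip: of_real_diff)
    also have "\<dots> \<le> t * r + (1 - t) * r"
      using that by (intro add_mono mult_left_mono) (auto simp: r_def)
    finally show ?thesis by (simp add: algebra_simps)
  qed
  define c where "c = (\<lambda>n. binc (p + q) n)"
  have c0: "c n \<ge> 0" for n using pq by (simp add: c_def binc_nonneg)
  define d where "d = (\<lambda>n. \<Sum>j\<le>n. of_real (binc p j) * x ^ j * (of_real (binc q (n - j)) * y ^ (n - j)))"
  have sumd: "d sums ((1 - x) powr (- of_real p) * (1 - y) powr (- of_real q))"
  proof -
    have "summable (\<lambda>k. norm (of_real (binc s k) * z ^ k))" if "norm z < 1" "s > 0" for s and z :: complex
      using binc_summable[of "norm z" s] that by (simp add: norm_mult norm_power binc_nonneg)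
    note this[OF xy(1) pq(1)] this[OF xy(2) pq(2)]
    from Cauchy_product_sums[OF this] show ?thesis unfolding d_def
      using binc_sums[OF xy(1), of p] binc_sums[OF xy(2), of q]
      by (simp add: sums_iff)
  qed
  have int: "((\<lambda>t. of_real (W t) * (\<Sum>n<N. of_real (c n) * u t ^ n)) has_integral
      of_real (Beta p q) * (\<Sum>n<N. d n)) {0..1}" for N
  proof -
    have "((\<lambda>t. of_real (W t) * (of_real (c n) * u t ^ n)) has_integral of_real (Beta p q) * d n) {0..1}" for n
    proof -
      have "((\<lambda>t. of_real (t powr (p + real j - 1) * (1 - t) powr (q + real (n - j) - 1)) * 1)
              has_integral complex_of_real (Beta (p + real j) (q + real (n - j))) * 1) {0..1}" for j
        unfolding mult_1_right using pq by (intro has_integral_of_real has_integral_Beta_real) auto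
      from Beta_integral_binomial[OF pq this] show ?thesis
        unfolding c_def u_def W_def d_def by (simp only: mult_1_right)
    qed
    hence "((\<lambda>t. \<Sum>n<N. of_real (W t) * (of_real (c n) * u t ^ n)) has_integral
        (\<Sum>n<N. of_real (Beta p q) * d n)) {0..1}"
      by (intro has_integral_sum) auto
    thus ?thesis by (simp only: sum_distrib_left)
  qed
  \<comment> \<open>The segment between y and x stays in the disc of radius r < 1, so the Beta
    weight times a constant dominates all partial sums, even where the weight is unbounded.\<close>
  have lim: "((\<lambda>t. of_real (W t) * (1 - u t) powr (- of_real (p + q))) has_integral
      of_real (Beta p q) * ((1 - x) powr (- of_real p) * (1 - y) powr (- of_real q))) {0..1}"
  proof (rule has_integral_dominated_convergence)
    show "((\<lambda>t. of_real (W t) * (\<Sum>n<N. of_real (c n) * u t ^ n)) has_integral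
      of_real (Beta p q) * (\<Sum>n<N. d n)) {0..1}" for N by (rule int)
    show "(\<lambda>t. W t * (\<Sum>n. c n * r ^ n)) integrable_on {0..1}"
      unfolding W_def using Beta_weight_integrable[OF pq] by (rule integrable_on_mult_left)
    show "\<forall>t\<in>{0..1}. norm (of_real (W t) * (\<Sum>n<N. of_real (c n) * u t ^ n)) \<le> W t * (\<Sum>n. c n * r ^ n)" for N
    proof
      fix t :: real assume t: "t \<in> {0..1}"
      have "norm (\<Sum>n<N. of_real (c n) * u t ^ n) \<le> (\<Sum>n<N. c n * r ^ n)"
        using u[OF t] c0
        by (intro order_trans[OF norm_sum] sum_mono) (auto simp: norm_mult norm_power intro!: mult_left_mono power_mono)
      also have "\<dots> \<le> (\<Sum>n. c n * r ^ n)"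
        using c0 r binc_summable[OF r, of "p + q"] by (intro sum_le_suminf) (auto simp: c_def)
      finally show "norm (of_real (W t) * (\<Sum>n<N. of_real (c n) * u t ^ n)) \<le> W t * (\<Sum>n. c n * r ^ n)"
        unfolding norm_mult by (intro mult_mono) (auto simp: W_def abs_mult simp del: of_real_mult)
    qed
    show "\<forall>t\<in>{0..1}. (\<lambda>N. of_real (W t) * (\<Sum>n<N. of_real (c n) * u t ^ n))
        \<longlonglongrightarrow> of_real (W t) * (1 - u t) powr (- of_real (p + q))"
    proof
      fix t :: real assume "t \<in> {0..1}"
      hence "norm (u t) < 1" using u[of t] r by simp
      from binc_sums[OF this, of "p + q"]
      show "(\<lambda>N. of_real (W t) * (\<Sum>n<N. of_real (c n) * u t ^ n))
        \<longlonglongrightarrow> of_real (W t) * (1 - u t) powr (- of_real (p + q))"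
        unfolding sums_def c_def by (rule tendsto_mult_left)
    qed
    show "(\<lambda>N. of_real (Beta p q) * (\<Sum>n<N. d n)) \<longlonglongrightarrow>
        of_real (Beta p q) * ((1 - x) powr (- of_real p) * (1 - y) powr (- of_real q))"
      using sumd unfolding sums_def by (rule tendsto_mult_left)
  qed
  have Mp: "of_real M powr (- of_real (p + q)) = of_real M powr (- of_real p) * (of_real M powr (- of_real q) :: complex)"
    by (simp add: powr_add[symmetric])
  have Mm: "(of_real M * w) powr z = of_real M powr z * w powr z" for w z :: complex
    using M0 by (intro powr_times_real_left) auto
  have eq1: "of_real t * A + of_real (1 - t) * B = of_real M * (1 - u t)" for t
    unfolding AM u_def by (simp add: algebra_simps)
  have eq2: "A powr (- of_real p) * B powr (- of_real q) =
     of_real M powr (- of_real (p + q)) * ((1 - x) powr (- of_real p) * (1 - y) powr (- of_real q))"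
    unfolding AM Mm Mp by (simp only: mult_ac)
  from has_integral_mult_right[OF lim, of "of_real M powr (- of_real (p + q))"]
  show ?thesis unfolding eq1 eq2 Mm W_def by (simp only: mult_ac)
qed

section \<open>The conic hull of the kernels\<close>

text \<open>\<open>pcoef v c n\<close> is the \<open>n\<close>-th Taylor coefficient at \<open>0\<close> of \<open>z \<mapsto> (v + (1 - v) z)\<^sup>-\<^sup>c\<close>.\<close>

definition pcoef :: "complex \<Rightarrow> real \<Rightarrow> nat \<Rightarrow> complex" where
  "pcoef v c n = of_real (binc c n) * (v - 1) ^ n * v powr (- of_real (c + real n))"

text \<open>With y = 1 - 1/v and Re v > 0, the kernel is (1 - y z)^(-c), multiplied by v^(-c) so
  that its value at z = 1 is 1.\<close>

lemma pcoef_eq: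
  assumes "v \<noteq> 0"
  shows "pcoef v c n = v powr (- of_real c) * (of_real (binc c n) * (1 - 1 / v) ^ n)"
proof -
  have "v powr (- of_real (c + real n)) = v powr (- of_real c) / v ^ n"
    using assms by (simp add: powr_diff)
  moreover have "1 - 1 / v = (v - 1) / v" using assms by (simp add: diff_divide_distrib)
  ultimately show ?thesis by (simp add: pcoef_def power_divide)
qed

text \<open>This is Feynman's formula for the bases v + (1 - v) z and w + (1 - w) z, whose mixtures
  are again of this form. Read coefficient by coefficient, it follows from the formula at z = 0 with
  raised exponents, and no integral is interchanged with a power series.\<close>

lemma pcoef_mult_has_integral:
  assumes v: "Re v > 0" and w: "Re w > 0" and pq: "p > 0" "q > 0"
  shows "((\<lambda>t. of_real (t powr (p - 1) * (1 - t) powr (q - 1)) *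
              pcoef (of_real t * v + of_real (1 - t) * w) (p + q) n) has_integral
           of_real (Beta p q) * (\<Sum>j\<le>n. pcoef v p j * pcoef w q (n - j))) {0..1}"
proof -
  define K where "K = (\<lambda>t::real. (of_real t * v + of_real (1 - t) * w) powr (- of_real (p + q + real n)))"
  define J where "J = (\<lambda>j. v powr (- of_real (p + real j)) * w powr (- of_real (q + real (n - j))))"
  have "((\<lambda>t. of_real (t powr (p + real j - 1) * (1 - t) powr (q + real (n - j) - 1)) * K t)
              has_integral of_real (Beta (p + real j) (q + real (n - j))) * J j) {0..1}" if "j \<le> n" for j
  proof -
    \<comment> \<open>The exponents have the same sum for every j, so one function \<open>K\<close>
      serves all terms of the binomial expansion.\<close>
    have "p + real j + (q + real (n - j)) = p + q + real n" using that by simp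
    thus ?thesis unfolding K_def J_def
      using Feynman_has_integral[OF v w, of "p + real j" "q + real (n - j)"] pq by (simp only:)
  qed
  from Beta_integral_binomial[OF pq this, of "v - 1" "w - 1"]
  have *: "((\<lambda>t. of_real (t powr (p - 1) * (1 - t) powr (q - 1)) *
            (of_real (binc (p + q) n) * (of_real t * (v - 1) + of_real (1 - t) * (w - 1)) ^ n * K t)) has_integral
          of_real (Beta p q) * (\<Sum>j\<le>n. of_real (binc p j) * (v - 1) ^ j * (of_real (binc q (n - j)) * (w - 1) ^ (n - j)) * J j)) {0..1}"
    by simp
  have "of_real t * (v - 1) + of_real (1 - t) * (w - 1) = of_real t * v + of_real (1 - t) * w - 1" for t
    by (simp add: algebra_simps)
  hence 1: "of_real (binc (p + q) n) * (of_real t * (v - 1) + of_real (1 - t) * (w - 1)) ^ n * K t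
      = pcoef (of_real t * v + of_real (1 - t) * w) (p + q) n" for t
    by (simp add: pcoef_def K_def)
  have 2: "of_real (binc p j) * (v - 1) ^ j * (of_real (binc q (n - j)) * (w - 1) ^ (n - j)) * J j
     = pcoef v p j * pcoef w q (n - j)" for j
    by (simp add: pcoef_def J_def mult_ac)
  from * show ?thesis unfolding 1 2 .
qed

text \<open>By duality this is the closed convex cone spanned by the kernels, with respect to
  convergence of each coefficient; testing with finitely supported functionals suffices and spares
  all summability conditions.\<close>

definition conic_hull :: "complex set \<Rightarrow> real \<Rightarrow> (nat \<Rightarrow> complex) \<Rightarrow> bool" where
  "conic_hull K c \<phi> \<longleftrightarrow> (\<forall>N l. (\<forall>v\<in>K. 0 \<le> Re (\<Sum>n<N. l n * pcoef v c n)) \<longrightarrow>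
                           0 \<le> Re (\<Sum>n<N. l n * \<phi> n))"

lemma conic_hullD:
  assumes "conic_hull K c \<phi>" "\<And>v. v \<in> K \<Longrightarrow> 0 \<le> Re (\<Sum>n<N. l n * pcoef v c n)"
  shows "0 \<le> Re (\<Sum>n<N. l n * \<phi> n)"
  using assms by (simp add: conic_hull_def)

lemma pcoef_0: "v \<noteq> 0 \<Longrightarrow> pcoef v 0 n = (if n = 0 then 1 else 0)"
  by (auto simp: pcoef_def binc_def pochhammer_0_left)

text \<open>As a functional of f, the sum is again finitely supported. This lets a hypothesis about
  one factor of a product be applied while the other factor is held fixed.\<close>

lemma convolution_functional:
  fixes l f g :: "nat \<Rightarrow> complex"
  shows "(\<Sum>n<N. l n * (\<Sum>j\<le>n. f j * g (n - j))) = (\<Sum>j<N. (\<Sum>n\<in>{j..<N}. l n * g (n - j)) * f j)"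
proof -
  have "(\<Sum>n<N. l n * (\<Sum>j\<le>n. f j * g (n - j))) = (\<Sum>n<N. \<Sum>j\<in>{j\<in>{..<N}. j \<le> n}. l n * (f j * g (n - j)))"
    unfolding sum_distrib_left by (intro sum.cong refl) auto
  also have "\<dots> = (\<Sum>j<N. \<Sum>n\<in>{n\<in>{..<N}. j \<le> n}. l n * (f j * g (n - j)))"
    by (rule sum.swap_restrict) auto
  also have "\<dots> = (\<Sum>j<N. (\<Sum>n\<in>{j..<N}. l n * g (n - j)) * f j)"
    unfolding sum_distrib_right by (intro sum.cong refl) (auto simp: mult_ac)
  finally show ?thesis .
qed

lemma pcoef_mult_in_hull:
  assumes K: "convex K" "\<And>v. v \<in> K \<Longrightarrow> Re v > 0" and vw: "v \<in> K" "w \<in> K"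
    and pq: "p \<ge> 0" "q \<ge> 0"
  shows "conic_hull K (p + q) (\<lambda>n. \<Sum>j\<le>n. pcoef v p j * pcoef w q (n - j))"
proof -
  have nz: "v \<noteq> 0" "w \<noteq> 0" using K(2)[OF vw(1)] K(2)[OF vw(2)] by auto
  \<comment> \<open>A vanishing exponent occurs when a part of the circle carries no mass. The Beta
    weight is then not integrable, but the kernel is the constant 1.\<close>
  consider "p = 0" | "q = 0" | "p > 0" "q > 0" using pq by fastforce
  thus ?thesis
  proof cases
    case 1
    have "(\<lambda>n. \<Sum>j\<le>n. pcoef v p j * pcoef w q (n - j)) = pcoef w q"
    proof
      fix n
      have "(\<Sum>j\<le>n. pcoef v p j * pcoef w q (n - j)) = (\<Sum>j\<le>n. if j = 0 then pcoef w q n else 0)"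
        using nz 1 by (intro sum.cong) (auto simp: pcoef_0)
      thus "(\<Sum>j\<le>n. pcoef v p j * pcoef w q (n - j)) = pcoef w q n" by simp
    qed
    thus ?thesis using 1 vw by (auto simp: conic_hull_def)
  next
    case 2
    have "(\<lambda>n. \<Sum>j\<le>n. pcoef v p j * pcoef w q (n - j)) = pcoef v p"
    proof
      fix n
      have "(\<Sum>j\<le>n. pcoef v p j * pcoef w q (n - j)) = (\<Sum>j\<le>n. if j = n then pcoef v p n else 0)"
        using nz 2 by (intro sum.cong) (auto simp: pcoef_0)
      thus "(\<Sum>j\<le>n. pcoef v p j * pcoef w q (n - j)) = pcoef v p n" by simp
    qed
    thus ?thesis using 2 vw by (auto simp: conic_hull_def)
  next
    case 3
    show ?thesis unfolding conic_hull_def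
    proof (intro allI impI)
      fix N l assume l: "\<forall>v\<in>K. 0 \<le> Re (\<Sum>n<N. l n * pcoef v (p + q) n)"
      let ?W = "\<lambda>t::real. t powr (p - 1) * (1 - t) powr (q - 1)"
      let ?u = "\<lambda>t::real. of_real t * v + of_real (1 - t) * w"
      let ?g = "\<lambda>n. \<Sum>j\<le>n. pcoef v p j * pcoef w q (n - j)"
      have ReM: "Re (of_real r * z) = r * Re z" for r z by simp
      have "((\<lambda>t. \<Sum>n<N. l n * (of_real (?W t) * pcoef (?u t) (p + q) n)) has_integral
              (\<Sum>n<N. l n * (of_real (Beta p q) * ?g n))) {0..1}"
        using K vw 3 by (intro has_integral_sum has_integral_mult_right pcoef_mult_has_integral) auto
      hence "((\<lambda>t. Re (\<Sum>n<N. l n * (of_real (?W t) * pcoef (?u t) (p + q) n))) has_integral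
              Re (\<Sum>n<N. l n * (of_real (Beta p q) * ?g n))) {0..1}"
        using has_integral_linear[OF _ bounded_linear_Re] by (simp only: o_def)
      \<comment> \<open>The finite functional has been moved under the integral; the integrand is
        nonnegative because convexity keeps the mixed point in \<open>K\<close>.\<close>
      hence "0 \<le> Re (\<Sum>n<N. l n * (of_real (Beta p q) * ?g n))"
      proof (rule has_integral_nonneg)
        fix t :: real assume t: "t \<in> {0..1}"
        have "?u t \<in> K"
          using convexD[OF K(1) vw, of t "1 - t"] t by (simp add: scaleR_conv_of_real)
        hence "0 \<le> ?W t * Re (\<Sum>n<N. l n * pcoef (?u t) (p + q) n)"
          using l by (intro mult_nonneg_nonneg) auto
        also have "\<dots> = Re (of_real (?W t) * (\<Sum>n<N. l n * pcoef (?u t) (p + q) n))"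
          by (rule ReM[symmetric])
        also have "\<dots> = Re (\<Sum>n<N. l n * (of_real (?W t) * pcoef (?u t) (p + q) n))"
          unfolding sum_distrib_left by (simp only: mult_ac)
        finally show "0 \<le> Re (\<Sum>n<N. l n * (of_real (?W t) * pcoef (?u t) (p + q) n))" .
      qed
      also have "(\<Sum>n<N. l n * (of_real (Beta p q) * ?g n)) = of_real (Beta p q) * (\<Sum>n<N. l n * ?g n)"
        unfolding sum_distrib_left[of "of_real (Beta p q)" _ "{..<N}"] by (intro sum.cong refl) (simp only: mult_ac)
      also have "Re \<dots> = Beta p q * Re (\<Sum>n<N. l n * ?g n)" by (rule ReM)
      finally have "0 \<le> Beta p q * Re (\<Sum>n<N. l n * ?g n)" .
      moreover have "Beta p q > 0"
        using 3 by (simp add: Beta_def Gamma_real_pos)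
      ultimately show "0 \<le> Re (\<Sum>n<N. l n * ?g n)"
        by (simp only: zero_le_mult_iff) linarith
    qed
  qed
qed

text \<open>A functional that is nonnegative on the kernels of exponent p + q, composed with
  multiplication by one kernel of exponent q, is nonnegative on the kernels of exponent p. So the
  case of two kernels extends to the whole hull by duality.\<close>

lemma conic_hull_mult_pcoef:
  assumes K: "convex K" "\<And>v. v \<in> K \<Longrightarrow> Re v > 0" and w: "w \<in> K"
    and pq: "p \<ge> 0" "q \<ge> 0" and \<phi>: "conic_hull K p \<phi>"
  shows "conic_hull K (p + q) (\<lambda>n. \<Sum>j\<le>n. \<phi> j * pcoef w q (n - j))"
  unfolding conic_hull_def
proof (intro allI impI)
  fix N l assume l: "\<forall>v\<in>K. 0 \<le> Re (\<Sum>n<N. l n * pcoef v (p + q) n)"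
  show "0 \<le> Re (\<Sum>n<N. l n * (\<Sum>j\<le>n. \<phi> j * pcoef w q (n - j)))"
    unfolding convolution_functional
  proof (rule conic_hullD[OF \<phi>])
    fix v assume v: "v \<in> K"
    have "0 \<le> Re (\<Sum>n<N. l n * (\<Sum>j\<le>n. pcoef v p j * pcoef w q (n - j)))"
      by (rule conic_hullD[OF pcoef_mult_in_hull[OF K v w pq]]) (use l in auto)
    thus "0 \<le> Re (\<Sum>j<N. (\<Sum>n\<in>{j..<N}. l n * pcoef w q (n - j)) * pcoef v p j)"
      unfolding convolution_functional .
  qed
qed

lemma conic_hull_prod:
  assumes K: "convex K" "\<And>v. v \<in> K \<Longrightarrow> Re v > 0" "K \<noteq> {}"
    and "finite A" "\<And>k. k \<in> A \<Longrightarrow> v k \<in> K" "\<And>k. k \<in> A \<Longrightarrow> c k \<ge> 0"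
  shows "conic_hull K (\<Sum>k\<in>A. c k) (fps_nth (\<Prod>k\<in>A. Abs_fps (pcoef (v k) (c k))))"
  using assms(4-6)
proof (induction A rule: finite_induct)
  case empty
  obtain v0 where v0: "v0 \<in> K" using K(3) by blast
  have "v0 \<noteq> 0" using K(2)[OF v0] by auto
  hence "fps_nth (1 :: complex fps) = pcoef v0 0" by (auto simp: pcoef_0 fps_one_nth)
  thus ?case using v0 by (auto simp: conic_hull_def)
next
  case (insert k A)
  have eq: "fps_nth (\<Prod>k\<in>insert k A. Abs_fps (pcoef (v k) (c k))) =
      (\<lambda>n. \<Sum>j\<le>n. fps_nth (\<Prod>k\<in>A. Abs_fps (pcoef (v k) (c k))) j * pcoef (v k) (c k) (n - j))"
    using insert.hyps by (subst prod.insert) (auto simp: fps_mult_nth mult.commute[of "Abs_fps _"] atLeast0AtMost)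
  have "conic_hull K ((\<Sum>k\<in>A. c k) + c k) (fps_nth (\<Prod>k\<in>insert k A. Abs_fps (pcoef (v k) (c k))))"
    unfolding eq using insert by (intro conic_hull_mult_pcoef[OF K(1,2)] sum_nonneg) auto
  thus ?case using insert.hyps by (simp add: add.commute)
qed

lemma conic_hull_LIMSEQ:
  assumes "\<And>i. conic_hull K c (\<phi> i)" "\<And>n. (\<lambda>i. \<phi> i n) \<longlonglongrightarrow> \<psi> n"
  shows "conic_hull K c \<psi>"
  unfolding conic_hull_def
proof (intro allI impI)
  fix N l assume l: "\<forall>v\<in>K. 0 \<le> Re (\<Sum>n<N. l n * pcoef v c n)"
  have "(\<lambda>i. Re (\<Sum>n<N. l n * \<phi> i n)) \<longlonglongrightarrow> Re (\<Sum>n<N. l n * \<psi> n)"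
    by (intro tendsto_intros assms)
  thus "0 \<le> Re (\<Sum>n<N. l n * \<psi> n)"
    by (rule LIMSEQ_le_const) (use conic_hullD[OF assms(1)] l in auto)
qed

lemma conic_hull_scale:
  assumes "conic_hull K c \<phi>" "r \<ge> 0"
  shows "conic_hull K c (\<lambda>n. of_real r * \<phi> n)"
  unfolding conic_hull_def
proof (intro allI impI)
  fix N l assume l: "\<forall>v\<in>K. 0 \<le> Re (\<Sum>n<N. l n * pcoef v c n)"
  have "(\<Sum>n<N. l n * (of_real r * \<phi> n)) = of_real r * (\<Sum>n<N. l n * \<phi> n)"
    unfolding sum_distrib_left by (simp only: mult_ac)
  thus "0 \<le> Re (\<Sum>n<N. l n * (of_real r * \<phi> n))"
    using conic_hullD[OF assms(1)] l assms(2) by simp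
qed

section \<open>Positivity on the hull\<close>

text \<open>For 0 <= \<rho> < 1 this is the image of the disc |y| <= \<rho> under y -> 1/(1 - y).
  Clearing the denominator excludes v = 0 without a separate condition.\<close>

definition vdisc :: "real \<Rightarrow> complex set" where
  "vdisc \<rho> = {v. norm (v - 1) \<le> \<rho> * norm v}"

lemma one_in_vdisc: "\<rho> \<ge> 0 \<Longrightarrow> 1 \<in> vdisc \<rho>"
  by (simp add: vdisc_def)

lemma norm_diff_one_sq: "(norm (v - 1 :: complex))\<^sup>2 = (norm v)\<^sup>2 - 2 * Re v + 1"
  unfolding cmod_power2 by (simp add: power2_eq_square algebra_simps)

lemma vdisc_Re_ge:
  assumes "0 \<le> \<rho>" "\<rho> < 1" "v \<in> vdisc \<rho>"
  shows "Re v \<ge> 1/2"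
proof -
  have "norm (v - 1) \<le> \<rho> * norm v" using assms by (simp add: vdisc_def)
  also have "\<dots> \<le> 1 * norm v" using assms by (intro mult_right_mono) auto
  finally have "(norm (v - 1))\<^sup>2 \<le> (norm v)\<^sup>2" by (intro power_mono) auto
  thus ?thesis unfolding norm_diff_one_sq by simp
qed

lemma vdisc_nonzero: "v \<in> vdisc \<rho> \<Longrightarrow> v \<noteq> 0"
  by (auto simp: vdisc_def)

lemma vdisc_iff: "v \<in> vdisc \<rho> \<longleftrightarrow> v \<noteq> 0 \<and> norm (1 - 1 / v) \<le> \<rho>"
proof (cases "v = 0")
  case False
  hence "1 - 1 / v = (v - 1) / v" by (simp add: diff_divide_distrib)
  thus ?thesis using False by (simp add: vdisc_def norm_divide divide_le_eq)
qed (auto dest: vdisc_nonzero)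

text \<open>Points at most \<rho> times as far from 1 as from 0 form an Apollonian disc; completing
  the square gives its centre k = 1/(1 - \<rho>^2) and radius \<rho> k.\<close>

lemma vdisc_convex:
  assumes "0 \<le> \<rho>" "\<rho> < 1"
  shows "convex (vdisc \<rho>)"
proof -
  define k where "k = 1 / (1 - \<rho>\<^sup>2)"
  have "\<rho>\<^sup>2 < 1" using assms by (simp add: power_less_one_iff)
  hence k: "k > 0" "k * (1 - \<rho>\<^sup>2) = 1" by (auto simp: k_def)
  have "vdisc \<rho> = cball (of_real k) (\<rho> * k)"
  proof (intro set_eqI)
    fix v :: complex
    have "v \<in> vdisc \<rho> \<longleftrightarrow> (norm (v - 1))\<^sup>2 \<le> (\<rho> * norm v)\<^sup>2"
      unfolding vdisc_def using assms by (simp add: power2_le_iff_abs_le)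
    also have "\<dots> \<longleftrightarrow> 0 \<le> k * ((\<rho> * norm v)\<^sup>2 - (norm (v - 1))\<^sup>2)"
      using k by (simp add: zero_le_mult_iff)
    also have "k * ((\<rho> * norm v)\<^sup>2 - (norm (v - 1))\<^sup>2)
        = - (k * (1 - \<rho>\<^sup>2)) * (norm v)\<^sup>2 + 2 * k * Re v - k"
      unfolding norm_diff_one_sq by (simp add: power_mult_distrib algebra_simps)
    also have "\<dots> = (\<rho> * k)\<^sup>2 - (norm (v - of_real k))\<^sup>2"
    proof -
      have "(norm (v - of_real k))\<^sup>2 = (norm v)\<^sup>2 - 2 * k * Re v + k\<^sup>2"
        unfolding cmod_power2 by (simp add: power2_eq_square algebra_simps)
      moreover have "k\<^sup>2 - (\<rho> * k)\<^sup>2 = k * (k * (1 - \<rho>\<^sup>2))"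
        by (simp add: power2_eq_square algebra_simps)
      ultimately show ?thesis using k(2) by simp
    qed
    also have "0 \<le> \<dots> \<longleftrightarrow> (norm (v - of_real k))\<^sup>2 \<le> (\<rho> * k)\<^sup>2" by linarith
    also have "\<dots> \<longleftrightarrow> norm (v - of_real k) \<le> \<rho> * k"
      using assms k by (simp add: power2_le_iff_abs_le)
    finally show "v \<in> vdisc \<rho> \<longleftrightarrow> v \<in> cball (of_real k) (\<rho> * k)"
      by (simp add: dist_norm norm_minus_commute)
  qed
  thus ?thesis by simp
qed

text \<open>Since |v| >= 1/2, the factor v^(-c) is at most 2^c in modulus, and |1 - 1/v| <= \<rho>
  supplies geometric decay. The bound does not depend on v, so series can be truncated uniformly
  over the kernels.\<close>

lemma norm_pcoef_le:
  assumes "0 \<le> \<rho>" "\<rho> < 1" "v \<in> vdisc \<rho>" "c \<ge> 0"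
  shows "norm (pcoef v c n) \<le> 2 powr c * (binc c n * \<rho> ^ n)"
proof -
  have v: "v \<noteq> 0" "norm (1 - 1 / v) \<le> \<rho>" using assms(3) by (auto simp: vdisc_iff)
  have "1/2 \<le> norm v" using vdisc_Re_ge[OF assms(1-3)] complex_Re_le_cmod[of v] by linarith
  hence "norm v powr (-c) \<le> (1/2) powr (-c)" using assms(4) by (intro powr_mono2') auto
  also have "(1/2) powr (-c) = (2::real) powr c" by (simp add: powr_minus powr_divide)
  finally have "norm (v powr (- of_real c)) \<le> 2 powr c" by (simp add: norm_powr_real_powr')
  thus ?thesis unfolding pcoef_eq[OF v(1)] norm_mult norm_power
    using v(2) binc_nonneg[OF assms(4)] by (intro mult_mono power_mono) (auto intro!: mult_nonneg_nonneg)
qed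

lemma norm_suminf_tail_le:
  fixes a :: "nat \<Rightarrow> 'a :: banach"
  assumes "\<And>n. norm (a n) \<le> b n" "summable b"
  shows "norm (suminf a - (\<Sum>n<N. a n)) \<le> suminf b - (\<Sum>n<N. b n)"
proof -
  have sa: "summable a" using assms by (auto intro: summable_comparison_test')
  have "suminf a - (\<Sum>n<N. a n) = (\<Sum>n. a (n + N))" using suminf_split_initial_segment[OF sa, of N] by simp
  also have "norm \<dots> \<le> (\<Sum>n. b (n + N))"
    using assms by (intro norm_suminf_le) (auto simp: summable_iff_shift)
  also have "\<dots> = suminf b - (\<Sum>n<N. b n)" using suminf_split_initial_segment[OF assms(2), of N] by simp
  finally show ?thesis .
qed

text \<open>The multiplier turns v^(-a) (1 - y z)^(-a) into v^(-a) (1 - y z)^(-b), where y = 1 -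
  1/v; the value at z = 1 follows from 1 - y = 1/v.\<close>

lemma pcoef_ratio_sums:
  assumes "0 \<le> \<rho>" "\<rho> < 1" "v \<in> vdisc \<rho>" "a > 0"
  shows "(\<lambda>n. of_real (binc b n / binc a n) * pcoef v a n) sums v powr (of_real (b - a))"
proof -
  have v: "v \<noteq> 0" "norm (1 - 1 / v) < 1" using assms by (auto simp: vdisc_iff)
  have "Re v > 0" using vdisc_Re_ge[OF assms(1-3)] by simp
  hence nr: "v \<notin> \<real>\<^sub>\<le>\<^sub>0" by (auto simp: complex_nonpos_Reals_iff)
  have "binc a n \<noteq> 0" for n using assms(4) pochhammer_pos[of a n] by (simp add: binc_def)
  hence eq: "of_real (binc b n / binc a n) * pcoef v a n
      = v powr (- of_real a) * (of_real (binc b n) * (1 - 1 / v) ^ n)" for n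
    unfolding pcoef_eq[OF v(1)] by (simp add: field_simps)
  have "(1 - (1 - 1 / v)) powr (- of_real b) = v powr (of_real b)"
    using v nr by (simp add: powr_def Ln_inverse[OF nr] divide_inverse[of 1])
  moreover have "v powr (- of_real a) * v powr (of_real b) = v powr (of_real (b - a))"
    by (simp flip: powr_add)
  ultimately show ?thesis unfolding eq
    using sums_mult[OF binc_sums[OF v(2), of b], of "v powr (- of_real a)"] by simp
qed

text \<open>Truncating \<open>l\<close> may destroy positivity on the kernels; adding a small multiple of the functional
  \<open>\<Sum>n<N. \<phi> n\<close>, which tends to \<open>1\<close> uniformly on the kernels, restores it.\<close>

lemma conic_hull_suminf:
  assumes \<rho>: "0 \<le> \<rho>" "\<rho> < 1" and a: "a > 0"
    and \<phi>: "conic_hull (vdisc \<rho>) a \<phi>"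
    and sl: "summable (\<lambda>n. norm (l n) * (binc a n * \<rho> ^ n))"
    and X: "(\<lambda>n. l n * \<phi> n) sums X" and Y: "\<phi> sums Y"
    and pos: "\<And>v. v \<in> vdisc \<rho> \<Longrightarrow> 0 \<le> Re (\<Sum>n. l n * pcoef v a n)"
  shows "0 \<le> Re X"
proof -
  \<comment> \<open>The factor 2 e balances the errors: truncation costs at most e, while the
    truncated sum of a kernel has real part at least 1/2 and so contributes at least e.\<close>
  have main: "0 \<le> Re (X + of_real (2 * e) * Y)" if e: "e > 0" for e
  proof -
    define B where "B = (\<lambda>n. 2 powr a * (norm (l n) * (binc a n * \<rho> ^ n)))"
    define D where "D = (\<lambda>n. 2 powr a * (binc a n * \<rho> ^ n))"
    have sB: "summable B" unfolding B_def using sl by (rule summable_mult)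
    have sD: "summable D" unfolding D_def using binc_summable[OF \<rho>] by (rule summable_mult)
    have "(\<lambda>N. suminf B - (\<Sum>n<N. B n)) \<longlonglongrightarrow> suminf B - suminf B"
      using sB by (intro tendsto_intros summable_LIMSEQ)
    hence "eventually (\<lambda>N. suminf B - (\<Sum>n<N. B n) < e) sequentially"
      using e by (intro order_tendstoD(2)) auto
    moreover have "(\<lambda>N. suminf D - (\<Sum>n<N. D n)) \<longlonglongrightarrow> suminf D - suminf D"
      using sD by (intro tendsto_intros summable_LIMSEQ)
    hence "eventually (\<lambda>N. suminf D - (\<Sum>n<N. D n) < 1/2) sequentially"
      by (intro order_tendstoD(2)) auto
    ultimately have ev: "eventually (\<lambda>N. 0 \<le> Re (\<Sum>n<N. (l n + of_real (2 * e)) * \<phi> n)) sequentially"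
    proof eventually_elim
      case (elim N)
      show ?case
      proof (rule conic_hullD[OF \<phi>])
        fix v assume v: "v \<in> vdisc \<rho>"
        let ?p = "pcoef v a"
        have pb: "norm (?p n) \<le> D n" for n unfolding D_def by (rule norm_pcoef_le) (use \<rho> v a in auto)
        have lb: "norm (l n * ?p n) \<le> B n" for n
          using mult_left_mono[OF pb[of n], of "norm (l n)"] by (simp add: norm_mult B_def D_def mult_ac)
        have "binc a n \<noteq> 0" for n using a pochhammer_pos[of a n] by (simp add: binc_def)
        hence "?p sums 1" using pcoef_ratio_sums[OF \<rho> v a, of a] vdisc_nonzero[OF v] by simp
        hence one: "suminf ?p = 1" by (simp add: sums_iff)
        have "norm (1 - (\<Sum>n<N. ?p n)) < 1/2"
          using norm_suminf_tail_le[OF pb sD, of N] elim unfolding one by linarith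
        hence 1: "Re (\<Sum>n<N. ?p n) \<ge> 1/2"
          using complex_Re_le_cmod[of "1 - (\<Sum>n<N. ?p n)"] by simp
        have "norm ((\<Sum>n. l n * ?p n) - (\<Sum>n<N. l n * ?p n)) < e"
          using norm_suminf_tail_le[OF lb sB, of N] elim by linarith
        hence 2: "Re (\<Sum>n<N. l n * ?p n) \<ge> - e"
          using complex_Re_le_cmod[of "(\<Sum>n. l n * ?p n) - (\<Sum>n<N. l n * ?p n)"] pos[OF v] by simp
        have "(\<Sum>n<N. (l n + of_real (2 * e)) * ?p n) = (\<Sum>n<N. l n * ?p n) + of_real (2 * e) * (\<Sum>n<N. ?p n)"
          unfolding sum_distrib_left ring_distribs sum.distrib ..
        hence "Re (\<Sum>n<N. (l n + of_real (2 * e)) * ?p n) = Re (\<Sum>n<N. l n * ?p n) + 2 * e * Re (\<Sum>n<N. ?p n)"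
          by (simp del: Re_sum)
        moreover have "2 * e * Re (\<Sum>n<N. ?p n) \<ge> 2 * e * (1/2)"
          using 1 e by (intro mult_left_mono) auto
        ultimately show "0 \<le> Re (\<Sum>n<N. (l n + of_real (2 * e)) * ?p n)" using 2 by simp
      qed
    qed
    have "(\<lambda>n. (l n + of_real (2 * e)) * \<phi> n) sums (X + of_real (2 * e) * Y)"
      unfolding ring_distribs by (intro sums_add sums_mult X Y)
    hence "(\<lambda>N. Re (\<Sum>n<N. (l n + of_real (2 * e)) * \<phi> n)) \<longlonglongrightarrow> Re (X + of_real (2 * e) * Y)"
      unfolding sums_def by (rule tendsto_Re)
    with ev show ?thesis by (intro tendsto_lowerbound[of _ _ sequentially]) auto
  qed
  have "((\<lambda>e. Re (X + of_real (2 * e) * Y)) \<longlongrightarrow> Re (X + of_real (2 * 0) * Y)) (at_right 0)"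
    by (intro tendsto_intros)
  moreover have "eventually (\<lambda>e. 0 \<le> Re (X + of_real (2 * e) * Y)) (at_right 0)"
    using main by (auto simp: eventually_at_right_less intro: eventually_at_right_less[THEN eventually_mono])
  ultimately show ?thesis by (intro tendsto_lowerbound[of "\<lambda>e. Re (X + of_real (2 * e) * Y)" "Re X" "at_right 0"]) auto
qed

text \<open>In the application, X0, X1 and Y are the values of H_b, H_(b+1) and H_(b+s) up to one
  common phase. The first conclusion is quadratic in \<open>\<phi>\<close>, so the form is polarized
  and the linear duality is used twice, once for each argument. Only \<open>binc (b + s)\<close> is
  divided by, which admits b = 0.\<close>

lemma conic_hull_quadratic:
  assumes \<rho>: "0 \<le> \<rho>" "\<rho> < 1" and b: "b \<ge> 0" and s: "0 \<le> s" "s \<le> 1" "b + s > 0"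
    and \<phi>: "conic_hull (vdisc \<rho>) (b + s) \<phi>"
    and X0: "(\<lambda>n. of_real (binc b n / binc (b + s) n) * \<phi> n) sums X0"
    and X1: "(\<lambda>n. of_real (binc (b + 1) n / binc (b + s) n) * \<phi> n) sums X1"
    and Y: "\<phi> sums Y"
  shows "0 \<le> Re ((2 * X1 - X0) * cnj X0)" "0 \<le> Re X0" "0 \<le> Re Y" "Im Y = 0"
proof -
  define K where "K = vdisc \<rho>"
  have bp: "binc (b + s) n > 0" for n using s(3) pochhammer_pos[of "b + s" n] by (simp add: binc_def)
  have lin: "0 \<le> Re (\<alpha> * X0 + \<beta> * X1)"
    if pos: "\<And>v. v \<in> K \<Longrightarrow> 0 \<le> Re (\<alpha> * v powr (- of_real s) + \<beta> * v powr (of_real (1 - s)))" for \<alpha> \<beta>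
  proof (rule conic_hull_suminf[OF \<rho> s(3) \<phi> _ _ Y])
    let ?l = "\<lambda>n. \<alpha> * of_real (binc b n / binc (b + s) n) + \<beta> * of_real (binc (b + 1) n / binc (b + s) n)"
    have "norm (?l n) * (binc (b + s) n * \<rho> ^ n) \<le> norm \<alpha> * (binc b n * \<rho> ^ n) + norm \<beta> * (binc (b + 1) n * \<rho> ^ n)" for n
    proof -
      have "norm (?l n) \<le> norm \<alpha> * (binc b n / binc (b + s) n) + norm \<beta> * (binc (b + 1) n / binc (b + s) n)"
        using b bp[of n] by (intro order_trans[OF norm_triangle_ineq] add_mono)
          (auto simp: norm_mult norm_divide binc_nonneg)
      hence "norm (?l n) * (binc (b + s) n * \<rho> ^ n) \<le>
          (norm \<alpha> * (binc b n / binc (b + s) n) + norm \<beta> * (binc (b + 1) n / binc (b + s) n)) * (binc (b + s) n * \<rho> ^ n)"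
        using bp[of n] \<rho> by (intro mult_right_mono) auto
      also have "\<dots> = norm \<alpha> * (binc b n * \<rho> ^ n) + norm \<beta> * (binc (b + 1) n * \<rho> ^ n)"
        using bp[of n] by (simp add: field_simps)
      finally show ?thesis .
    qed
    thus "summable (\<lambda>n. norm (?l n) * (binc (b + s) n * \<rho> ^ n))"
      using bp \<rho> by (intro summable_comparison_test'[OF summable_add[OF summable_mult[OF binc_summable[OF \<rho>, of b], of "norm \<alpha>"]
          summable_mult[OF binc_summable[OF \<rho>, of "b + 1"], of "norm \<beta>"]]]) (auto simp: abs_mult less_imp_le)
    show "(\<lambda>n. ?l n * \<phi> n) sums (\<alpha> * X0 + \<beta> * X1)"
      unfolding ring_distribs mult.assoc by (intro sums_add sums_mult X0 X1)
    fix v assume v: "v \<in> vdisc \<rho>"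
    have "(\<lambda>n. ?l n * pcoef v (b + s) n) sums (\<alpha> * v powr (of_real (b - (b + s))) + \<beta> * v powr (of_real (b + 1 - (b + s))))"
      unfolding ring_distribs mult.assoc by (intro sums_add sums_mult pcoef_ratio_sums[OF \<rho> v s(3)])
    thus "0 \<le> Re (\<Sum>n. ?l n * pcoef v (b + s) n)" using pos[of v] v by (simp add: sums_iff K_def)
  qed
  let ?P0 = "\<lambda>v::complex. v powr (- of_real s)" and ?P1 = "\<lambda>v::complex. v powr (of_real (1 - s))"
  have Re_K: "Re v \<ge> 1/2" if "v \<in> K" for v using vdisc_Re_ge[OF \<rho>] that by (simp add: K_def)
  have P1: "?P1 v = v * ?P0 v" if "v \<in> K" for v
  proof -
    have "v \<noteq> 0" using Re_K[OF that] by auto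
    hence "v powr (1 + (- of_real s)) = v * ?P0 v" by (subst powr_add) simp
    thus ?thesis by simp
  qed
  have cnjP: "cnj (?P0 v) = cnj v powr (- of_real s)" if "v \<in> K" for v
    using Re_K[OF that] by (subst cnj_powr) (auto simp: complex_nonpos_Reals_iff)
  \<comment> \<open>The polarized form at two kernels: since \<open>?P1 v = v * ?P0 v\<close>, it is
    twice the expression of \<open>Re_powr_kernel_nonneg\<close> with A = v and B = cnj w.\<close>
  have kernel: "0 \<le> Re ((2 * ?P1 v - ?P0 v) * cnj (?P0 w) + ?P0 v * cnj (2 * ?P1 w - ?P0 w))"
    if "v \<in> K" "w \<in> K" for v w
  proof -
    have "(2 * ?P1 v - ?P0 v) * cnj (?P0 w) + ?P0 v * cnj (2 * ?P1 w - ?P0 w)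
        = of_real 2 * ((v + cnj w - 1) * ?P0 v * cnj (?P0 w))"
      unfolding P1[OF that(1)] P1[OF that(2)] by (simp add: algebra_simps)
    moreover have "0 \<le> Re ((v + cnj w - 1) * ?P0 v * cnj (?P0 w))"
      unfolding cnjP[OF that(2)] using Re_K[OF that(1)] Re_K[OF that(2)] s
      by (intro Re_powr_kernel_nonneg) auto
    moreover have "Re (of_real 2 * z) = 2 * Re z" for z by simp
    ultimately show ?thesis by (simp only:)
  qed
  \<comment> \<open>First use of duality: for a fixed kernel w the expression is complex linear in
    X0 and X1.\<close>
  have half: "0 \<le> Re ((2 * X1 - X0) * cnj (?P0 w) + X0 * cnj (2 * ?P1 w - ?P0 w))" if w: "w \<in> K" for w
  proof -
    have "0 \<le> Re ((cnj (2 * ?P1 w - ?P0 w) - cnj (?P0 w)) * X0 + (2 * cnj (?P0 w)) * X1)"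
    proof (rule lin)
      fix v assume v: "v \<in> K"
      have "(cnj (2 * ?P1 w - ?P0 w) - cnj (?P0 w)) * ?P0 v + (2 * cnj (?P0 w)) * ?P1 v
          = (2 * ?P1 v - ?P0 v) * cnj (?P0 w) + ?P0 v * cnj (2 * ?P1 w - ?P0 w)"
        by (simp only: algebra_simps)
      thus "0 \<le> Re ((cnj (2 * ?P1 w - ?P0 w) - cnj (?P0 w)) * ?P0 v + (2 * cnj (?P0 w)) * ?P1 v)"
        using kernel[OF v w] by (simp only:)
    qed
    also have "(cnj (2 * ?P1 w - ?P0 w) - cnj (?P0 w)) * X0 + (2 * cnj (?P0 w)) * X1
        = (2 * X1 - X0) * cnj (?P0 w) + X0 * cnj (2 * ?P1 w - ?P0 w)"
      by (simp only: algebra_simps)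
    finally show ?thesis .
  qed
  \<comment> \<open>Second use of duality: X0 and X1 now supply the coefficients and w runs through
    the kernels. Conjugation exchanges the two arguments and keeps the real part.\<close>
  have "0 \<le> Re ((cnj (2 * X1 - X0) - cnj X0) * X0 + (2 * cnj X0) * X1)"
  proof (rule lin)
    fix w assume w: "w \<in> K"
    have "cnj ((cnj (2 * X1 - X0) - cnj X0) * ?P0 w + (2 * cnj X0) * ?P1 w)
        = (2 * X1 - X0) * cnj (?P0 w) + X0 * cnj (2 * ?P1 w - ?P0 w)"
      by (simp add: algebra_simps)
    hence "0 \<le> Re (cnj ((cnj (2 * X1 - X0) - cnj X0) * ?P0 w + (2 * cnj X0) * ?P1 w))"
      using half[OF w] by (simp only:)
    thus "0 \<le> Re ((cnj (2 * X1 - X0) - cnj X0) * ?P0 w + (2 * cnj X0) * ?P1 w)"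
      by (simp only: cnj.sel)
  qed
  also have "Re ((cnj (2 * X1 - X0) - cnj X0) * X0 + (2 * cnj X0) * X1) = 2 * Re ((2 * X1 - X0) * cnj X0)"
    by (simp add: algebra_simps)
  finally show "0 \<le> Re ((2 * X1 - X0) * cnj X0)" by simp
  have "0 \<le> Re (1 * X0 + 0 * X1)"
  proof (rule lin)
    fix v assume "v \<in> K"
    hence v: "v \<noteq> 0" "Re v > 0" using Re_K[of v] by auto
    have "\<bar>s * Im (Ln v)\<bar> \<le> 1 * (pi/2)" unfolding abs_mult
      using s Re_Ln_pos_lt_imp[OF v(2)] by (intro mult_mono) auto
    hence "cos (s * Im (Ln v)) \<ge> 0" by (intro cos_ge_zero; linarith)
    thus "0 \<le> Re (1 * ?P0 v + 0 * ?P1 v)" using v by (simp add: powr_def Re_exp)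
  qed
  thus "0 \<le> Re X0" by simp
  \<comment> \<open>Every kernel sums to 1, so multiplication by any \<alpha> with nonnegative real
    part is an admissible functional; i and -i then force Y to be real.\<close>
  have Yl: "0 \<le> Re (\<alpha> * Y)" if "0 \<le> Re \<alpha>" for \<alpha>
  proof (rule conic_hull_suminf[OF \<rho> s(3) \<phi> _ _ Y])
    show "summable (\<lambda>n. norm \<alpha> * (binc (b + s) n * \<rho> ^ n))" by (intro summable_mult binc_summable \<rho>)
    show "(\<lambda>n. \<alpha> * \<phi> n) sums (\<alpha> * Y)" by (intro sums_mult Y)
    fix v assume v: "v \<in> vdisc \<rho>"
    have "pcoef v (b + s) sums 1"
      using pcoef_ratio_sums[OF \<rho> v s(3), of "b + s"] bp vdisc_nonzero[OF v] by (simp add: less_imp_neq[symmetric])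
    hence "(\<lambda>n. \<alpha> * pcoef v (b + s) n) sums (\<alpha> * 1)" by (rule sums_mult)
    thus "0 \<le> Re (\<Sum>n. \<alpha> * pcoef v (b + s) n)" using that by (simp add: sums_iff)
  qed
  show "0 \<le> Re Y" using Yl[of 1] by simp
  show "Im Y = 0" using Yl[of \<i>] Yl[of "-\<i>"] by simp
qed

section \<open>Discretized Herglotz measures\<close>

text \<open>The logarithmic derivative of (1 - y z)^(-c), times z, is the sum of c y^j z^j over j >=
  1. Multiplied out, this comes down to n (c)_n/n! being c times the sum of (c)_i/i! over i <
  n.\<close>

lemma fps_binc_deriv:
  fixes y :: complex
  shows "fps_X * fps_deriv (Abs_fps (\<lambda>n. of_real (binc c n) * y ^ n)) =
    Abs_fps (\<lambda>j. if j = 0 then 0 else of_real c * y ^ j) * Abs_fps (\<lambda>n. of_real (binc c n) * y ^ n)"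
proof (rule fps_ext)
  fix n
  have binc_sum: "real n * binc c n = c * (\<Sum>i<n. binc c i)"
  proof (induction n)
    case (Suc n)
    have "real (Suc n) * binc c (Suc n) = (c + real n) * binc c n"
      by (simp add: binc_def pochhammer_Suc field_simps del: of_nat_Suc)
    also have "\<dots> = c * (\<Sum>i<Suc n. binc c i)" using Suc by (simp add: algebra_simps)
    finally show ?case .
  qed simp
  have "fps_nth (Abs_fps (\<lambda>j. if j = 0 then 0 else of_real c * y ^ j) * Abs_fps (\<lambda>n. of_real (binc c n) * y ^ n)) n
     = (\<Sum>i\<le>n. (if i = 0 then 0 else of_real c * y ^ i) * (of_real (binc c (n - i)) * y ^ (n - i)))"
    by (simp add: fps_mult_nth atLeast0AtMost)
  also have "\<dots> = (\<Sum>i\<le>n. (if n - i = 0 then 0 else of_real c * y ^ (n - i)) * (of_real (binc c (n - (n - i))) * y ^ (n - (n - i))))"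
    by (rule sum.reindex_bij_witness[of _ "\<lambda>i. n - i" "\<lambda>i. n - i"]) auto
  also have "\<dots> = (\<Sum>i<n. of_real c * of_real (binc c i) * y ^ n)"
    by (rule sum.mono_neutral_cong_right) (auto simp: power_add[symmetric])
  also have "\<dots> = of_real (c * (\<Sum>i<n. binc c i)) * y ^ n"
    by (simp add: sum_distrib_left sum_distrib_right)
  also have "\<dots> = of_nat n * of_real (binc c n) * y ^ n" unfolding binc_sum[symmetric] by simp
  also have "\<dots> = fps_nth (fps_X * fps_deriv (Abs_fps (\<lambda>n. of_real (binc c n) * y ^ n))) n"
    by (cases n) auto
  finally show "fps_nth (fps_X * fps_deriv (Abs_fps (\<lambda>n. of_real (binc c n) * y ^ n))) n =
     fps_nth (Abs_fps (\<lambda>j. if j = 0 then 0 else of_real c * y ^ j) * Abs_fps (\<lambda>n. of_real (binc c n) * y ^ n)) n" ..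
qed

lemma fps_prod_log_deriv:
  fixes B S :: "'i \<Rightarrow> 'a :: comm_ring_1 fps"
  assumes "finite A" "\<And>k. k \<in> A \<Longrightarrow> fps_X * fps_deriv (B k) = S k * B k"
  shows "fps_X * fps_deriv (\<Prod>k\<in>A. B k) = (\<Sum>k\<in>A. S k) * (\<Prod>k\<in>A. B k)"
  using assms
proof (induction A rule: finite_induct)
  case (insert k A)
  have "fps_X * fps_deriv (\<Prod>k\<in>insert k A. B k)
      = B k * (fps_X * fps_deriv (\<Prod>k\<in>A. B k)) + (fps_X * fps_deriv (B k)) * (\<Prod>k\<in>A. B k)"
    using insert.hyps by (simp add: algebra_simps)
  also have "\<dots> = (\<Sum>k\<in>insert k A. S k) * (\<Prod>k\<in>insert k A. B k)"
    using insert by (simp add: algebra_simps)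
  finally show ?case .
qed simp

text \<open>The equation X F' = S F is the recursion that n F_n is the sum of S_j F_(n-j) over 1 <=
  j <= n. Convergence of the coefficients of S thus carries over to F by induction, without
  logarithms or uniform convergence.\<close>

lemma fps_log_deriv_LIMSEQ:
  fixes F S :: "nat \<Rightarrow> complex fps"
  assumes F: "\<And>i. fps_X * fps_deriv (F i) = S i * F i" "\<And>i. fps_nth (F i) 0 = 1"
    and G: "fps_X * fps_deriv G = T * G" "fps_nth G 0 = 1"
    and S0: "\<And>i. fps_nth (S i) 0 = 0" "fps_nth T 0 = 0"
    and lim: "\<And>j. j > 0 \<Longrightarrow> (\<lambda>i. fps_nth (S i) j) \<longlonglongrightarrow> fps_nth T j"
  shows "(\<lambda>i. fps_nth (F i) n) \<longlonglongrightarrow> fps_nth G n"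
proof (induction n rule: less_induct)
  case (less n)
  show ?case
  proof (cases n)
    case 0
    thus ?thesis using F(2) G(2) by simp
  next
    case (Suc m)
    have rec: "fps_nth H n = (\<Sum>j=1..n. fps_nth U j * fps_nth H (n - j)) / of_nat n"
      if "fps_X * fps_deriv H = U * H" "fps_nth U 0 = 0" for H U :: "complex fps"
    proof -
      have "of_nat n * fps_nth H n = fps_nth (fps_X * fps_deriv H) n" using Suc by simp
      also have "\<dots> = (\<Sum>j=0..n. fps_nth U j * fps_nth H (n - j))" unfolding that(1) fps_mult_nth ..
      also have "\<dots> = (\<Sum>j=1..n. fps_nth U j * fps_nth H (n - j))"
        using that(2) by (simp add: sum.atLeast_Suc_atMost)
      finally have "of_nat n * fps_nth H n = (\<Sum>j=1..n. fps_nth U j * fps_nth H (n - j))" .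
      moreover have "of_nat n \<noteq> (0 :: complex)" unfolding of_nat_eq_0_iff using Suc by simp
      ultimately show ?thesis by (metis nonzero_mult_div_cancel_left)
    qed
    have "(\<lambda>i. (\<Sum>j=1..n. fps_nth (S i) j * fps_nth (F i) (n - j)) / of_nat n)
        \<longlonglongrightarrow> (\<Sum>j=1..n. fps_nth T j * fps_nth G (n - j)) / of_nat n"
      using Suc by (intro tendsto_divide tendsto_sum tendsto_mult lim less tendsto_const) (auto simp del: of_nat_Suc)
    thus ?thesis using rec[OF F(1) S0(1)] rec[OF G(1) S0(2)] by simp
  qed
qed

section \<open>Fourier coefficients of the real part on a circle\<close>

lemma circle_mean_coeff:
  assumes g: "g holomorphic_on ball 0 1" and r: "0 < r" "r < 1"
  shows "((\<lambda>x. g (of_real r * exp (2 * of_real pi * \<i> * of_real x)) * exp (- (2 * of_real pi * \<i> * of_real x)) ^ j)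
           has_integral fps_nth (fps_expansion g 0) j * of_real r ^ j) {0..1}"
proof -
  have "cball 0 r \<subseteq> ball (0::complex) 1" using r by (auto simp: dist_norm)
  hence "((\<lambda>u. g u / (u - 0) ^ Suc j) has_contour_integral (2 * pi * \<i>) / fact j * (deriv ^^ j) g 0)
      (circlepath 0 r)"
    using r g by (intro Cauchy_has_contour_integral_higher_derivative_circlepath)
      (auto intro: holomorphic_on_subset holomorphic_on_imp_continuous_on)
  hence "((\<lambda>x. g (circlepath 0 r x) / (circlepath 0 r x) ^ Suc j * (2 * of_real pi * \<i> * of_real r * exp (2 * of_real pi * \<i> * of_real x)))
     has_integral (2 * of_real pi * \<i>) / fact j * (deriv ^^ j) g 0) {0..1}"
    unfolding has_contour_integral vector_derivative_circlepath by simp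
  from has_integral_mult_right[OF this, of "of_real r ^ j / (2 * of_real pi * \<i>)"]
  have *: "((\<lambda>x. of_real r ^ j / (2 * of_real pi * \<i>) * (g (circlepath 0 r x) / (circlepath 0 r x) ^ Suc j * (2 * of_real pi * \<i> * of_real r * exp (2 * of_real pi * \<i> * of_real x))))
     has_integral fps_nth (fps_expansion g 0) j * of_real r ^ j) {0..1}"
    by (simp add: fps_expansion_def mult_ac)
  have "of_real r ^ j / (2 * of_real pi * \<i>) * (g (circlepath 0 r x) / (circlepath 0 r x) ^ Suc j * (2 * of_real pi * \<i> * of_real r * exp (2 * of_real pi * \<i> * of_real x)))
     = g (of_real r * exp (2 * of_real pi * \<i> * of_real x)) * exp (- (2 * of_real pi * \<i> * of_real x)) ^ j" for x
    using r by (simp add: circlepath exp_minus power_mult_distrib field_simps)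
  thus ?thesis using * by (simp only:)
qed

text \<open>Re g is the mean of g and its conjugate. The conjugate contributes only for j = 0,
  because the mean of g z^j over the circle is its value at 0; hence the factor 1/2 for j > 0 and
  none for j = 0.\<close>

lemma circle_mean_Re_coeff:
  assumes g: "g holomorphic_on ball 0 1" and r: "0 < r" "r < 1"
  shows "((\<lambda>x. of_real (Re (g (of_real r * exp (2 * of_real pi * \<i> * of_real x)))) * exp (- (2 * of_real pi * \<i> * of_real x)) ^ j)
           has_integral (if j = 0 then of_real (Re (g 0)) else fps_nth (fps_expansion g 0) j * of_real r ^ j / 2)) {0..1}"
    (is "(?f has_integral _) _")
proof -
  let ?e = "\<lambda>x::real. exp (2 * of_real pi * \<i> * of_real x)"
  let ?d = "\<lambda>x::real. exp (- (2 * of_real pi * \<i> * of_real x))"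
  have "(\<lambda>z. g z * z ^ j) holomorphic_on ball 0 1" by (intro holomorphic_intros g)
  from circle_mean_coeff[OF this r, of 0]
  have "((\<lambda>x. g (of_real r * ?e x) * (of_real r * ?e x) ^ j) has_integral g 0 * 0 ^ j) {0..1}"
    by (simp add: fps_expansion_def)
  from has_integral_mult_right[OF this, of "1 / of_real r ^ j"]
  have "((\<lambda>x. 1 / of_real r ^ j * (g (of_real r * ?e x) * (of_real r * ?e x) ^ j)) has_integral g 0 * 0 ^ j) {0..1}"
    by (simp add: power_0_left split: if_splits)
  hence "((\<lambda>x. g (of_real r * ?e x) * ?e x ^ j) has_integral g 0 * 0 ^ j) {0..1}"
    using r by (simp add: power_mult_distrib)
  hence "((\<lambda>x. cnj (g (of_real r * ?e x) * ?e x ^ j)) has_integral cnj (g 0 * 0 ^ j)) {0..1}"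
    using has_integral_linear[OF _ bounded_linear_cnj] by (simp only: o_def)
  hence "((\<lambda>x. cnj (g (of_real r * ?e x)) * ?d x ^ j) has_integral cnj (g 0 * 0 ^ j)) {0..1}"
    by (simp add: exp_cnj)
  from has_integral_mult_right[OF has_integral_add[OF circle_mean_coeff[OF g r, of j] this], of "1/2"]
  have "((\<lambda>x. 1/2 * (g (of_real r * ?e x) * ?d x ^ j + cnj (g (of_real r * ?e x)) * ?d x ^ j)) has_integral
      1/2 * (fps_nth (fps_expansion g 0) j * of_real r ^ j + cnj (g 0 * 0 ^ j))) {0..1}" .
  also have "(\<lambda>x. 1/2 * (g (of_real r * ?e x) * ?d x ^ j + cnj (g (of_real r * ?e x)) * ?d x ^ j)) = ?f"
    by (simp add: ring_distribs[symmetric] complex_add_cnj)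
  also have "1/2 * (fps_nth (fps_expansion g 0) j * of_real r ^ j + cnj (g 0 * 0 ^ j)) =
     (if j = 0 then of_real (Re (g 0)) else fps_nth (fps_expansion g 0) j * of_real r ^ j / 2)"
    by (auto simp: fps_expansion_def complex_add_cnj)
  finally show ?thesis .
qed

lemma integral_partition:
  fixes f :: "real \<Rightarrow> 'a :: banach"
  assumes "f integrable_on {0..1}" "N > 0"
  shows "(\<Sum>k<N. integral {real k / real N..real (Suc k) / real N} f) = integral {0..1} f"
proof -
  have "(\<Sum>k<m. integral {real k / real N..real (Suc k) / real N} f) = integral {0..real m / real N} f" if "m \<le> N" for m
    using that
  proof (induction m)
    case (Suc m)
    have "integral {0..real m / real N} f + integral {real m / real N..real (Suc m) / real N} f
        = integral {0..real (Suc m) / real N} f"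
      using Suc.prems assms(2)
      by (intro Henstock_Kurzweil_Integration.integral_combine integrable_on_subinterval[OF assms(1)])
         (auto simp: divide_simps)
    thus ?case using Suc by simp
  qed simp
  from this[of N] assms show ?thesis by simp
qed

lemma norm_exp_i_diff_le:
  "norm (exp (- (2 * of_real pi * \<i> * of_real s)) - exp (- (2 * of_real pi * \<i> * of_real x))) \<le> 2 * pi * \<bar>s - x\<bar>"
proof -
  have "exp (- (2 * of_real pi * \<i> * of_real s)) - exp (- (2 * of_real pi * \<i> * of_real x))
      = exp (- (2 * of_real pi * \<i> * of_real x)) * (exp (\<i> * of_real (2 * pi * (x - s))) - 1)"
    by (simp add: ring_distribs exp_add[symmetric] algebra_simps)
  also have "norm \<dots> = 2 * \<bar>sin (2 * pi * (x - s) / 2)\<bar>"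
    by (simp only: norm_mult dist_exp_i_1) simp
  also have "\<dots> \<le> 2 * \<bar>2 * pi * (x - s) / 2\<bar>"
    by (intro mult_left_mono abs_sin_x_le_abs_x) auto
  finally show ?thesis by (simp add: abs_mult abs_minus_commute)
qed

text \<open>The weight \<open>c i k\<close> is the mass of \<open>2 Re (g (r exp (2\<pi>ix))) dx\<close> on the \<open>k\<close>-th of \<open>i + 1\<close> equal parts of
  \<open>[0, 1]\<close>.\<close>

lemma Herglotz_approximation:
  fixes g :: "complex \<Rightarrow> complex" and z0 :: complex
  assumes g: "g holomorphic_on ball 0 1" and pos: "\<And>z. z \<in> ball 0 1 \<Longrightarrow> Re (g z) \<ge> 0"
    and r: "0 < r" "r < 1"
  obtains c :: "nat \<Rightarrow> nat \<Rightarrow> real" and y :: "nat \<Rightarrow> nat \<Rightarrow> complex"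
  where "\<And>i k. c i k \<ge> 0" "\<And>i k. norm (y i k) = norm z0 / r"
    "\<And>i. (\<Sum>k<Suc i. c i k) = 2 * Re (g 0)"
    "\<And>j. j > 0 \<Longrightarrow> (\<lambda>i. \<Sum>k<Suc i. of_real (c i k) * y i k ^ j) \<longlonglongrightarrow> fps_nth (fps_expansion g 0) j * z0 ^ j"
proof -
  define \<psi> where "\<psi> = (\<lambda>x::real. Re (g (of_real r * exp (2 * of_real pi * \<i> * of_real x))))"
  define D where "D = (\<lambda>x::real. exp (- (2 * of_real pi * \<i> * of_real x)))"
  define I where "I = (\<lambda>i k. {real k / real (Suc i)..real (Suc k) / real (Suc i)})"
  define c where "c = (\<lambda>i k. 2 * integral (I i k) \<psi>)"
  \<comment> \<open>Building z0 into the nodes turns evaluation at z0 into evaluation at 1; for |z0|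
    < r they lie in the open unit disc.\<close>
  define y where "y = (\<lambda>i k. z0 / of_real r * D (real k / real (Suc i)))"
  have inb: "of_real r * exp (2 * of_real pi * \<i> * of_real x) \<in> ball (0::complex) 1" for x :: real
    using r by (simp add: norm_mult norm_exp_eq_Re)
  have \<psi>0: "\<psi> x \<ge> 0" for x unfolding \<psi>_def by (rule pos[OF inb])
  have cont\<psi>: "continuous_on A \<psi>" for A
    unfolding \<psi>_def using inb
    by (intro continuous_intros continuous_on_compose2[OF holomorphic_on_imp_continuous_on[OF g]]) auto
  have contD: "continuous_on A D" for A unfolding D_def by (intro continuous_intros)
  have int\<psi>: "\<psi> integrable_on {a..b}" for a b by (rule integrable_continuous_real[OF cont\<psi>])
  have intc: "(\<lambda>x. of_real (\<psi> x) * D x ^ j) integrable_on {a..b}" for a b j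
    by (intro integrable_continuous_real continuous_intros cont\<psi> contD)
  have intI: "integral {0..1} \<psi> = Re (g 0)"
  proof -
    have "((\<lambda>x. of_real (\<psi> x)) has_integral complex_of_real (Re (g 0))) {0..1}"
      using circle_mean_Re_coeff[OF g r, of 0] by (simp add: \<psi>_def)
    hence "((\<lambda>x. Re (of_real (\<psi> x))) has_integral Re (complex_of_real (Re (g 0)))) {0..1}"
      using has_integral_linear[OF _ bounded_linear_Re] by (simp only: o_def)
    thus ?thesis by (simp add: integral_unique)
  qed
  have intj: "integral {0..1} (\<lambda>x. of_real (\<psi> x) * D x ^ j) = fps_nth (fps_expansion g 0) j * of_real r ^ j / 2"
    if "j > 0" for j
    using circle_mean_Re_coeff[OF g r, of j] that by (simp add: \<psi>_def D_def integral_unique)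
  have sumI: "(\<Sum>k<Suc i. integral (I i k) f) = integral {0..1} f"
    if "f integrable_on {0..1}" for i and f :: "real \<Rightarrow> 'b :: banach"
    unfolding I_def by (rule integral_partition[OF that]) simp
  have normD: "norm (D x) = 1" for x by (simp add: D_def norm_exp_eq_Re)
  show ?thesis
  proof (rule that)
    show "c i k \<ge> 0" for i k unfolding c_def I_def using \<psi>0 int\<psi> by (simp add: integral_nonneg)
    show "norm (y i k) = norm z0 / r" for i k using r by (simp add: y_def norm_mult norm_divide normD)
    show "(\<Sum>k<Suc i. c i k) = 2 * Re (g 0)" for i
      unfolding c_def sum_distrib_left[symmetric] sumI[OF int\<psi>] intI ..
    fix j :: nat assume j: "j > 0"
    define \<zeta> where "\<zeta> = (z0 / of_real r) ^ j"
    define C where "C = 2 * norm \<zeta> * (real j * (2 * pi)) * Re (g 0)"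
    \<comment> \<open>On each part, exp (-2 pi i x)^j is replaced by its value at the left end, at a
      cost of at most 2 pi j / (i + 1) times the mass. The total mass is the same for all i, so the
      error is O(1/i).\<close>
    have bound: "norm ((\<Sum>k<Suc i. of_real (c i k) * y i k ^ j) - fps_nth (fps_expansion g 0) j * z0 ^ j) \<le> C * inverse (real (Suc i))" for i
    proof -
      have term_le: "norm (integral (I i k) (\<lambda>x. of_real (\<psi> x) * (D (real k / real (Suc i)) ^ j - D x ^ j)))
          \<le> real j * (2 * pi) * inverse (real (Suc i)) * integral (I i k) \<psi>" for k
      proof -
        have "norm (integral (I i k) (\<lambda>x. of_real (\<psi> x) * (D (real k / real (Suc i)) ^ j - D x ^ j)))
            \<le> integral (I i k) (\<lambda>x. real j * (2 * pi) * inverse (real (Suc i)) * \<psi> x)"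
        proof (rule integral_norm_bound_integral)
          show "(\<lambda>x. of_real (\<psi> x) * (D (real k / real (Suc i)) ^ j - D x ^ j)) integrable_on I i k"
            unfolding I_def by (intro integrable_continuous_real continuous_intros cont\<psi> contD)
          show "(\<lambda>x. real j * (2 * pi) * inverse (real (Suc i)) * \<psi> x) integrable_on I i k"
            unfolding I_def by (intro integrable_continuous_real continuous_intros cont\<psi>)
          fix x assume x: "x \<in> I i k"
          have "norm (D (real k / real (Suc i)) ^ j - D x ^ j) \<le> real j * norm (D (real k / real (Suc i)) - D x)"
            by (rule norm_power_diff) (simp_all add: normD)
          also have "\<dots> \<le> real j * (2 * pi * \<bar>real k / real (Suc i) - x\<bar>)"
            unfolding D_def by (intro mult_left_mono norm_exp_i_diff_le) auto
          also have "\<dots> \<le> real j * (2 * pi * inverse (real (Suc i)))"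
          proof -
            have "\<bar>real k / real (Suc i) - x\<bar> \<le> inverse (real (Suc i))"
            proof -
              have "real (Suc k) / M = real k / M + inverse M" for M :: real
                by (simp add: add_divide_distrib inverse_eq_divide)
              hence "real k / real (Suc i) \<le> x" "x \<le> real k / real (Suc i) + inverse (real (Suc i))"
                using x by (simp_all only: I_def atLeastAtMost_iff)
              moreover have "\<bar>u - x\<bar> \<le> d" if "u \<le> x" "x \<le> u + d" for u d :: real
                using that by (simp add: abs_le_iff)
              ultimately show ?thesis by blast
            qed
            thus ?thesis by (intro mult_left_mono) auto
          qed
          finally have L: "norm (D (real k / real (Suc i)) ^ j - D x ^ j) \<le> real j * (2 * pi * inverse (real (Suc i)))" .
          show "norm (of_real (\<psi> x) * (D (real k / real (Suc i)) ^ j - D x ^ j))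
             \<le> real j * (2 * pi) * inverse (real (Suc i)) * \<psi> x"
            (is "norm (_ * ?X) \<le> ?Y * _")
          proof -
            have "\<psi> x * norm ?X \<le> \<psi> x * (real j * (2 * pi * inverse (real (Suc i))))"
              by (intro mult_left_mono L \<psi>0)
            moreover have "norm (of_real (\<psi> x) * ?X) = \<psi> x * norm ?X" using \<psi>0[of x] by (simp only: norm_mult norm_of_real abs_of_nonneg)
            ultimately show ?thesis by (simp only: mult_ac)
          qed
        qed
        thus ?thesis by simp
      qed
      have "of_real (c i k) * y i k ^ j - 2 * \<zeta> * integral (I i k) (\<lambda>x. of_real (\<psi> x) * D x ^ j)
          = 2 * \<zeta> * integral (I i k) (\<lambda>x. of_real (\<psi> x) * (D (real k / real (Suc i)) ^ j - D x ^ j))" for k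
      proof -
        have "(\<psi> has_integral integral (I i k) \<psi>) (I i k)"
          unfolding I_def using int\<psi> by (rule integrable_integral)
        hence "((\<lambda>x. of_real (\<psi> x) * D (real k / real (Suc i)) ^ j) has_integral
            of_real (integral (I i k) \<psi>) * D (real k / real (Suc i)) ^ j) (I i k)"
          by (intro has_integral_mult_left has_integral_of_real)
        moreover have "((\<lambda>x. of_real (\<psi> x) * D x ^ j) has_integral integral (I i k) (\<lambda>x. of_real (\<psi> x) * D x ^ j)) (I i k)"
          unfolding I_def using intc by (rule integrable_integral)
        ultimately have "((\<lambda>x. of_real (\<psi> x) * D (real k / real (Suc i)) ^ j - of_real (\<psi> x) * D x ^ j) has_integral
            of_real (integral (I i k) \<psi>) * D (real k / real (Suc i)) ^ j - integral (I i k) (\<lambda>x. of_real (\<psi> x) * D x ^ j)) (I i k)"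
          by (rule has_integral_diff)
        hence "integral (I i k) (\<lambda>x. of_real (\<psi> x) * (D (real k / real (Suc i)) ^ j - D x ^ j))
            = of_real (integral (I i k) \<psi>) * D (real k / real (Suc i)) ^ j - integral (I i k) (\<lambda>x. of_real (\<psi> x) * D x ^ j)"
          (is "?J = _") unfolding right_diff_distrib by (rule integral_unique)
        hence "2 * \<zeta> * ?J = 2 * \<zeta> * (of_real (integral (I i k) \<psi>) * D (real k / real (Suc i)) ^ j)
            - 2 * \<zeta> * integral (I i k) (\<lambda>x. of_real (\<psi> x) * D x ^ j)"
          by (simp only: right_diff_distrib)
        moreover have "of_real (c i k) * y i k ^ j = 2 * \<zeta> * (of_real (integral (I i k) \<psi>) * D (real k / real (Suc i)) ^ j)"
          by (simp only: c_def y_def \<zeta>_def power_mult_distrib of_real_mult of_real_numeral mult_ac)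
        ultimately show ?thesis by (simp only:)
      qed
      hence "(\<Sum>k<Suc i. of_real (c i k) * y i k ^ j) - 2 * \<zeta> * (\<Sum>k<Suc i. integral (I i k) (\<lambda>x. of_real (\<psi> x) * D x ^ j))
         = (\<Sum>k<Suc i. 2 * \<zeta> * integral (I i k) (\<lambda>x. of_real (\<psi> x) * (D (real k / real (Suc i)) ^ j - D x ^ j)))"
        unfolding sum_distrib_left sum_subtractf[symmetric] by (intro sum.cong refl)
      moreover have "2 * \<zeta> * (\<Sum>k<Suc i. integral (I i k) (\<lambda>x. of_real (\<psi> x) * D x ^ j)) = fps_nth (fps_expansion g 0) j * z0 ^ j"
        unfolding sumI[OF intc] intj[OF j] \<zeta>_def using r by (simp add: power_divide)
      ultimately have "norm ((\<Sum>k<Suc i. of_real (c i k) * y i k ^ j) - fps_nth (fps_expansion g 0) j * z0 ^ j)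
          = norm (\<Sum>k<Suc i. 2 * \<zeta> * integral (I i k) (\<lambda>x. of_real (\<psi> x) * (D (real k / real (Suc i)) ^ j - D x ^ j)))"
        by (simp only:)
      also have "\<dots> \<le> (\<Sum>k<Suc i. 2 * norm \<zeta> * (real j * (2 * pi) * inverse (real (Suc i)) * integral (I i k) \<psi>))"
      proof (intro order_trans[OF norm_sum] sum_mono)
        fix k
        show "norm (2 * \<zeta> * integral (I i k) (\<lambda>x. of_real (\<psi> x) * (D (real k / real (Suc i)) ^ j - D x ^ j)))
           \<le> 2 * norm \<zeta> * (real j * (2 * pi) * inverse (real (Suc i)) * integral (I i k) \<psi>)"
          unfolding norm_mult norm_numeral by (intro mult_left_mono[OF term_le]) simp
      qed
      also have "\<dots> = C * inverse (real (Suc i))"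
      proof -
        have "(\<Sum>k<Suc i. 2 * norm \<zeta> * (real j * (2 * pi) * inverse (real (Suc i)) * integral (I i k) \<psi>))
            = 2 * norm \<zeta> * (real j * (2 * pi) * inverse (real (Suc i)) * (\<Sum>k<Suc i. integral (I i k) \<psi>))"
          unfolding sum_distrib_left ..
        also have "\<dots> = C * inverse (real (Suc i))"
          unfolding sumI[OF int\<psi>] intI C_def by (simp only: mult_ac)
        finally show ?thesis .
      qed
      finally show ?thesis .
    qed
    have "(\<lambda>i. C * inverse (real (Suc i))) \<longlonglongrightarrow> C * 0"
      by (intro tendsto_mult_left LIMSEQ_inverse_real_of_nat)
    hence "(\<lambda>i. C * inverse (real (Suc i))) \<longlonglongrightarrow> 0" by (simp only: mult_zero_right)
    from Lim_null_comparison[OF always_eventually[OF allI[OF bound]] this]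
    show "(\<lambda>i. \<Sum>k<Suc i. of_real (c i k) * y i k ^ j) \<longlonglongrightarrow> fps_nth (fps_expansion g 0) j * z0 ^ j"
      by (rule LIM_zero_cancel)
  qed
qed

section \<open>From the logarithmic derivative to the conic hull\<close>

lemma fps_expansion_log_deriv:
  assumes h: "h holomorphic_on ball 0 1" and nz: "\<And>z. z \<in> ball 0 1 \<Longrightarrow> h z \<noteq> 0"
  shows "fps_X * fps_deriv (fps_expansion h 0) = fps_expansion (\<lambda>z. z * deriv h z / h z) 0 * fps_expansion h 0"
proof -
  let ?p = "\<lambda>z. z * deriv h z / h z"
  have H: "h has_fps_expansion fps_expansion h 0" using h by (intro has_fps_expansion_fps_expansion[of "ball 0 1"]) auto
  have "?p holomorphic_on ball 0 1" using nz by (intro holomorphic_intros h) auto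
  hence P: "?p has_fps_expansion fps_expansion ?p 0" by (intro has_fps_expansion_fps_expansion[of "ball 0 1"]) auto
  have "(\<lambda>z. z * deriv h z) has_fps_expansion fps_X * fps_deriv (fps_expansion h 0)"
    by (intro fps_expansion_intros H)
  moreover have "(\<lambda>z. ?p z * h z) has_fps_expansion fps_expansion ?p 0 * fps_expansion h 0"
    by (intro fps_expansion_intros H P)
  moreover have "eventually (\<lambda>z. z \<in> ball (0::complex) 1) (nhds 0)"
    by (rule eventually_nhds_in_open) auto
  hence "eventually (\<lambda>z. ?p z * h z = z * deriv h z) (nhds 0)"
    by eventually_elim (use nz in simp)
  ultimately have "(\<lambda>z. z * deriv h z) has_fps_expansion fps_expansion ?p 0 * fps_expansion h 0"
    by (subst (asm) has_fps_expansion_cong[OF _ refl])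
  with \<open>(\<lambda>z. z * deriv h z) has_fps_expansion fps_X * fps_deriv (fps_expansion h 0)\<close> show ?thesis
    by (rule fps_expansion_unique_complex)
qed

lemma fps_const_prod:
  "fps_const (\<Prod>k\<in>A. f k :: 'a :: comm_ring_1) = (\<Prod>k\<in>A. fps_const (f k))"
  by (induction A rule: infinite_finite_induct) (auto simp flip: fps_const_mult)

lemma fps_nth_0_prod:
  "fps_nth (\<Prod>k\<in>A. f k :: 'a :: comm_ring_1 fps) 0 = (\<Prod>k\<in>A. fps_nth (f k) 0)"
  by (induction A rule: infinite_finite_induct) auto

text \<open>The real part condition says that \<open>h\<close> is a limit of products \<open>\<Prod> (1 - y\<^sub>k z)\<^sup>-\<^sup>c\<^sup>k\<close> with
  \<open>\<Sum> c\<^sub>k = a\<close>; the unimodular factor \<open>\<kappa>\<close> comes from normalizing the factors.\<close>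

lemma conic_hull_if_log_deriv:
  assumes h: "h holomorphic_on ball 0 1" and nz: "\<And>z. z \<in> ball 0 1 \<Longrightarrow> h z \<noteq> 0" and h0: "h 0 = 1"
    and re: "\<And>z. z \<in> ball 0 1 \<Longrightarrow> Re (z * deriv h z / h z) \<ge> - a / 2"
    and z0: "z0 \<in> ball 0 1"
  obtains \<rho> \<kappa> where "0 \<le> \<rho>" "\<rho> < 1" "norm \<kappa> = 1"
    "conic_hull (vdisc \<rho>) a (\<lambda>n. \<kappa> * (fps_nth (fps_expansion h 0) n * z0 ^ n))"
proof -
  obtain r where r: "norm z0 < r" "r < 1" using z0 dense by (auto simp: dist_norm)
  hence r0: "0 < r" using norm_ge_zero[of z0] by linarith
  define \<rho> where "\<rho> = norm z0 / r"
  have \<rho>: "0 \<le> \<rho>" "\<rho> < 1" using r r0 by (auto simp: \<rho>_def)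
  let ?p = "\<lambda>z. z * deriv h z / h z"
  \<comment> \<open>Adding a/2 makes the real part nonnegative. Since \<open>?p\<close> vanishes at
    0, the total mass \<open>2 * Re (?g 0)\<close> is exactly a.\<close>
  let ?g = "\<lambda>z. ?p z + of_real (a / 2)"
  have p: "?p holomorphic_on ball 0 1" using nz by (intro holomorphic_intros h) auto
  have "?g holomorphic_on ball 0 1" by (intro holomorphic_intros p)
  moreover have "Re (?g z) \<ge> 0" if "z \<in> ball 0 1" for z using re[OF that] by simp
  ultimately obtain c y where c: "\<And>i k. c i k \<ge> (0::real)" and y: "\<And>i k. norm (y i k) = norm z0 / r"
    and csum: "\<And>i. (\<Sum>k<Suc i. c i k) = 2 * Re (?g 0)"
    and lim: "\<And>j. j > 0 \<Longrightarrow> (\<lambda>i. \<Sum>k<Suc i. of_real (c i k) * y i k ^ j) \<longlonglongrightarrow> fps_nth (fps_expansion ?g 0) j * z0 ^ j"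
    using Herglotz_approximation[of ?g r z0] r0 r(2) by blast
  have g_p: "fps_nth (fps_expansion ?g 0) j = fps_nth (fps_expansion ?p 0) j" if "j > 0" for j
  proof -
    have "?p has_fps_expansion fps_expansion ?p 0" using p by (intro has_fps_expansion_fps_expansion[of "ball 0 1"]) auto
    hence "?g has_fps_expansion fps_expansion ?p 0 + fps_const (of_real (a / 2))" by (intro fps_expansion_intros)
    moreover have "?g has_fps_expansion fps_expansion ?g 0"
      by (intro has_fps_expansion_fps_expansion[of "ball 0 1"] holomorphic_intros p) auto
    ultimately have "fps_expansion ?g 0 = fps_expansion ?p 0 + fps_const (of_real (a / 2))"
      using fps_expansion_unique_complex by blast
    thus ?thesis using that by simp
  qed
  define B where "B = (\<lambda>i k. Abs_fps (\<lambda>n. of_real (binc (c i k) n) * y i k ^ n))"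
  define S where "S = (\<lambda>i k. Abs_fps (\<lambda>j. if j = 0 then 0 else of_real (c i k) * y i k ^ j))"
  define F where "F = (\<lambda>i. \<Prod>k<Suc i. B i k)"
  define v where "v = (\<lambda>i k. 1 / (1 - y i k))"
  define \<kappa> where "\<kappa> = (\<lambda>i. \<Prod>k<Suc i. v i k powr (- of_real (c i k)))"
  have y1: "y i k \<noteq> 1" for i k using y[of i k] \<rho> by (auto simp: \<rho>_def)
  have v: "v i k \<noteq> 0" "1 - 1 / v i k = y i k" for i k using y1[of i k] by (auto simp: v_def)
  hence vd: "v i k \<in> vdisc \<rho>" for i k using y[of i k] by (simp add: vdisc_iff \<rho>_def)
  have "Abs_fps (pcoef (v i k) (c i k)) = fps_const (v i k powr (- of_real (c i k))) * B i k" for i k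
    by (rule fps_ext) (simp add: pcoef_eq[OF v(1)] v(2) B_def)
  hence prod: "(\<Prod>k<Suc i. Abs_fps (pcoef (v i k) (c i k))) = fps_const (\<kappa> i) * F i" for i
    by (simp only: prod.distrib \<kappa>_def F_def fps_const_prod)
  have \<kappa>0: "\<kappa> i \<noteq> 0" for i unfolding \<kappa>_def using v(1) by simp
  \<comment> \<open>The moduli of the \<open>\<kappa> i\<close> are divided out, which a cone
    permits. The remaining phases lie on the unit circle, where compactness gives a convergent
    subsequence.\<close>
  define \<omega> where "\<omega> = (\<lambda>i. \<kappa> i / of_real (norm (\<kappa> i)))"
  have \<omega>: "\<omega> i \<in> sphere 0 1" for i using \<kappa>0 by (simp add: \<omega>_def norm_divide)
  have hull0: "conic_hull (vdisc \<rho>) a (fps_nth (fps_const (\<kappa> i) * F i))" for i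
  proof -
    have "conic_hull (vdisc \<rho>) (\<Sum>k<Suc i. c i k) (fps_nth (\<Prod>k<Suc i. Abs_fps (pcoef (v i k) (c i k))))"
    proof (rule conic_hull_prod)
      show "Re w > 0" if "w \<in> vdisc \<rho>" for w using vdisc_Re_ge[OF \<rho> that] by linarith
      show "vdisc \<rho> \<noteq> {}" using one_in_vdisc[OF \<rho>(1)] by blast
    qed (rule vdisc_convex[OF \<rho>] finite_lessThan vd c)+
    moreover have "(\<Sum>k<Suc i. c i k) = a" unfolding csum by simp
    ultimately show ?thesis unfolding prod by (simp only:)
  qed
  have hull: "conic_hull (vdisc \<rho>) a (\<lambda>n. \<omega> i * fps_nth (F i) n)" for i
    using conic_hull_scale[OF hull0[of i], of "1 / norm (\<kappa> i)"] by (simp add: \<omega>_def)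
  \<comment> \<open>The series of h(z0 z) and of its logarithmic derivative times z, to match the
    nodes that contain z0.\<close>
  define H where "H = Abs_fps (\<lambda>n. fps_nth (fps_expansion h 0) n * z0 ^ n)"
  define T where "T = Abs_fps (\<lambda>n. fps_nth (fps_expansion ?p 0) n * z0 ^ n)"
  have limF: "(\<lambda>i. fps_nth (F i) n) \<longlonglongrightarrow> fps_nth H n" for n
  proof (rule fps_log_deriv_LIMSEQ)
    show "fps_X * fps_deriv (F i) = (\<Sum>k<Suc i. S i k) * F i" for i
      unfolding F_def by (rule fps_prod_log_deriv) (simp_all only: finite_lessThan B_def S_def fps_binc_deriv)
    show "fps_nth (F i) 0 = 1" for i
      unfolding F_def by (simp add: fps_nth_0_prod B_def del: prod.lessThan_Suc)
    show "fps_X * fps_deriv H = T * H"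
    proof (rule fps_ext)
      fix n
      have "fps_nth (fps_X * fps_deriv H) n = fps_nth (fps_X * fps_deriv (fps_expansion h 0)) n * z0 ^ n"
        by (cases n) (auto simp: H_def)
      also have "\<dots> = fps_nth (fps_expansion ?p 0 * fps_expansion h 0) n * z0 ^ n"
        using fps_expansion_log_deriv[OF h nz] by (simp only:)
      also have "\<dots> = fps_nth (T * H) n"
        unfolding fps_mult_nth sum_distrib_right T_def H_def
        by (intro sum.cong refl) (auto simp: power_add[symmetric])
      finally show "fps_nth (fps_X * fps_deriv H) n = fps_nth (T * H) n" .
    qed
    show "fps_nth H 0 = 1" using h0 by (simp add: H_def fps_expansion_def)
    show "fps_nth (\<Sum>k<Suc i. S i k) 0 = 0" for i by (simp add: fps_sum_nth S_def del: sum.lessThan_Suc)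
    show "fps_nth T 0 = 0" by (simp add: T_def fps_expansion_def)
    show "(\<lambda>i. fps_nth (\<Sum>k<Suc i. S i k) j) \<longlonglongrightarrow> fps_nth T j" if "j > 0" for j
      using lim[OF that] that unfolding g_p[OF that] by (simp add: fps_sum_nth S_def T_def del: sum.lessThan_Suc)
  qed
  obtain \<kappa>' \<sigma> where \<kappa>': "\<kappa>' \<in> sphere 0 1" "strict_mono \<sigma>" "(\<omega> \<circ> \<sigma>) \<longlonglongrightarrow> \<kappa>'"
    using compact_imp_seq_compact[OF compact_sphere[of "0::complex" 1]] \<omega> unfolding seq_compact_def by meson
  have "conic_hull (vdisc \<rho>) a (\<lambda>n. \<kappa>' * fps_nth H n)"
  proof (rule conic_hull_LIMSEQ)
    show "conic_hull (vdisc \<rho>) a (\<lambda>n. \<omega> (\<sigma> i) * fps_nth (F (\<sigma> i)) n)" for i by (rule hull)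
    show "(\<lambda>i. \<omega> (\<sigma> i) * fps_nth (F (\<sigma> i)) n) \<longlonglongrightarrow> \<kappa>' * fps_nth H n" for n
      using tendsto_mult[OF \<kappa>'(3) LIMSEQ_subseq_LIMSEQ[OF limF[of n] \<kappa>'(2)]] by (simp only: o_def)
  qed
  moreover have "norm \<kappa>' = 1" using \<kappa>'(1) by simp
  ultimately show ?thesis using that[OF \<rho>, of \<kappa>'] by (simp only: H_def fps_nth_Abs_fps)
qed

section \<open>Binomial multipliers\<close>

definition binc_mult :: "real \<Rightarrow> complex fps \<Rightarrow> complex fps" where
  "binc_mult c E = Abs_fps (\<lambda>n. of_real (binc c n) * fps_nth E n)"

lemma binc_mult_nth [simp]: "fps_nth (binc_mult c E) n = of_real (binc c n) * fps_nth E n"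
  by (simp add: binc_mult_def)

lemma less_fps_conv_radius:
  fixes z :: complex and E :: "complex fps"
  assumes "fps_conv_radius E \<ge> 1" "norm z < 1"
  shows "ereal (norm z) < fps_conv_radius E"
proof -
  have "ereal (norm z) < 1" using assms(2) by simp
  thus ?thesis using assms(1) by (rule less_le_trans)
qed

lemma fps_conv_radius_binc_mult:
  assumes E: "fps_conv_radius E \<ge> 1" and c: "c \<ge> 0"
  shows "fps_conv_radius (binc_mult c E) \<ge> 1"
  unfolding fps_conv_radius_def
proof (rule conv_radius_geI_ex')
  fix r :: real assume r: "0 < r" "ereal r < 1"
  \<comment> \<open>Of the two factors in r = s s, one keeps the terms of \<open>E\<close> bounded
    and the other makes the binomial series converge.\<close>
  define s where "s = sqrt r"
  have s: "0 \<le> s" "s < 1" "r = s * s" using r by (auto simp: s_def)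
  have "norm (complex_of_real s) < 1" using s by simp
  from summable_fps[OF less_fps_conv_radius[OF E this]]
  have "(\<lambda>n. fps_nth E n * of_real s ^ n) \<longlonglongrightarrow> 0" by (rule summable_LIMSEQ_zero)
  hence "Bseq (\<lambda>n. fps_nth E n * complex_of_real s ^ n)" by (intro convergent_imp_Bseq convergentI)
  then obtain C where "\<forall>n. norm (fps_nth E n * of_real s ^ n) \<le> C" by (rule BseqE)
  hence C: "norm (fps_nth E n * of_real s ^ n) \<le> C" for n by blast
  show "summable (\<lambda>n. fps_nth (binc_mult c E) n * of_real r ^ n)"
  proof (rule summable_comparison_test'[of _ 0])
    show "summable (\<lambda>n. C * (binc c n * s ^ n))" by (intro summable_mult binc_summable s)
    fix n :: nat
    have "fps_nth (binc_mult c E) n * of_real r ^ n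
        = (fps_nth E n * of_real s ^ n) * of_real (binc c n * s ^ n)"
      by (simp add: s(3) power_mult_distrib)
    hence "norm (fps_nth (binc_mult c E) n * of_real r ^ n) = norm (fps_nth E n * of_real s ^ n) * (binc c n * s ^ n)"
      using s(1) binc_nonneg[OF c, of n] by (simp only: norm_mult norm_of_real) simp
    also have "\<dots> \<le> C * (binc c n * s ^ n)"
      using s(1) binc_nonneg[OF c, of n] by (intro mult_right_mono C) auto
    finally show "norm (fps_nth (binc_mult c E) n * of_real r ^ n) \<le> C * (binc c n * s ^ n)" .
  qed
qed

text \<open>The minimum principle for the real part: a nonconstant g is open, so a value on the line
  Re = m would force values to the left of it. It yields both the absence of zeros of H_b and the
  strict inequality in R_1.\<close>

lemma Re_greater_if_Re_ge:
  assumes g: "g holomorphic_on ball 0 1" and ge: "\<And>z. z \<in> ball 0 1 \<Longrightarrow> Re (g z) \<ge> m"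
    and g0: "Re (g 0) > m" and z: "z \<in> ball 0 1"
  shows "Re (g z) > m"
proof (rule ccontr)
  assume "\<not> Re (g z) > m"
  hence eq: "Re (g z) = m" using ge[OF z] by simp
  have "\<not> g constant_on ball 0 1"
  proof
    assume "g constant_on ball 0 1"
    hence "g z = g 0" using z unfolding constant_on_def by (metis centre_in_ball zero_less_one)
    thus False using eq g0 by simp
  qed
  hence "open (g ` ball 0 1)" using g by (intro open_mapping_thm[of _ "ball 0 1"]) auto
  moreover have "g z \<in> g ` ball 0 1" using z by blast
  ultimately obtain e where e: "e > 0" "ball (g z) e \<subseteq> g ` ball 0 1" by (meson open_contains_ball)
  have "g z - of_real (e/2) \<in> ball (g z) e" using e(1) by (simp add: dist_norm)
  then obtain w where "w \<in> ball 0 1" "g z - of_real (e/2) = g w" using e(2) by blast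
  hence "Re (g z) - e/2 \<ge> m" using ge[of w] by (metis Re_complex_of_real minus_complex.sel(1))
  thus False using eq e(1) by simp
qed

context
  fixes E :: "complex fps" and H :: "real \<Rightarrow> complex \<Rightarrow> complex"
  assumes E: "fps_conv_radius E \<ge> 1" and E0: "fps_nth E 0 = 1"
  defines "H \<equiv> \<lambda>c. eval_fps (binc_mult c E)"
begin

lemma binc_mult_sums: "c \<ge> 0 \<Longrightarrow> norm z < 1 \<Longrightarrow> (\<lambda>n. of_real (binc c n) * fps_nth E n * z ^ n) sums H c z"
  using sums_eval_fps[OF less_fps_conv_radius[OF fps_conv_radius_binc_mult[OF E]], of c z] by (simp add: H_def)

lemma binc_mult_0: "H c 0 = 1" by (simp add: H_def eval_fps_at_0 E0)

lemma binc_mult_holomorphic: "c \<ge> 0 \<Longrightarrow> H c holomorphic_on ball 0 1"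
  unfolding H_def by (intro holomorphic_on_eval_fps)
    (auto intro!: less_fps_conv_radius[OF fps_conv_radius_binc_mult[OF E]] simp: in_eball_iff)

lemma binc_mult_expansion: "c \<ge> 0 \<Longrightarrow> fps_expansion (H c) 0 = binc_mult c E"
  unfolding H_def using fps_conv_radius_binc_mult[OF E, of c]
  by (intro fps_expansion_eqI) (auto simp: has_fps_expansion_def intro: less_le_trans[of 0 1])

text \<open>Coefficientwise this is (n + c) (c)_n = c (c + 1)_n. It trades the derivative for
  another multiplier, which can be evaluated on the kernels.\<close>

lemma binc_mult_Suc:
  assumes c: "c \<ge> 0" and z: "norm z < 1"
  shows "z * deriv (H c) z + of_real c * H c z = of_real c * H (c + 1) z"
proof -
  let ?F = "binc_mult c E"
  have rF: "ereal (norm z) < fps_conv_radius ?F"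
    by (rule less_fps_conv_radius[OF fps_conv_radius_binc_mult[OF E c] z])
  have "(\<lambda>n. fps_nth (fps_deriv ?F) n * z ^ n) sums deriv (H c) z"
    using sums_eval_fps[of z "fps_deriv ?F"] rF fps_conv_radius_deriv[of ?F] eval_fps_deriv[OF rF]
    unfolding H_def by (metis less_le_trans)
  hence "(\<lambda>n. z * (fps_nth (fps_deriv ?F) n * z ^ n)) sums (z * deriv (H c) z)" by (rule sums_mult)
  hence "(\<lambda>n. of_nat (Suc n) * fps_nth ?F (Suc n) * z ^ Suc n) sums (z * deriv (H c) z)"
    by (simp add: mult_ac)
  hence "(\<lambda>n. of_nat n * fps_nth ?F n * z ^ n) sums (z * deriv (H c) z + of_nat 0 * fps_nth ?F 0 * z ^ 0)"
    by (subst (asm) sums_Suc_iff[of "\<lambda>n. of_nat n * fps_nth ?F n * z ^ n"]) simp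
  hence 1: "(\<lambda>n. of_nat n * (of_real (binc c n) * fps_nth E n) * z ^ n) sums (z * deriv (H c) z)" by simp
  have "(\<lambda>n. of_nat n * (of_real (binc c n) * fps_nth E n) * z ^ n + of_real c * (of_real (binc c n) * fps_nth E n * z ^ n))
      sums (z * deriv (H c) z + of_real c * H c z)"
    by (intro sums_add 1 sums_mult binc_mult_sums c z)
  moreover have "of_nat n * (of_real (binc c n) * fps_nth E n) * z ^ n + of_real c * (of_real (binc c n) * fps_nth E n * z ^ n)
      = of_real c * (of_real (binc (c + 1) n) * fps_nth E n * z ^ n)" for n
  proof -
    have "pochhammer c (Suc n) = c * pochhammer (c + 1) n" by (rule pochhammer_rec)
    hence "(real n + c) * binc c n = c * binc (c + 1) n"
      by (simp add: binc_def pochhammer_Suc field_simps)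
    hence "of_real ((real n + c) * binc c n) * (fps_nth E n * z ^ n) = of_real (c * binc (c + 1) n) * (fps_nth E n * z ^ n)"
      by (simp only:)
    thus ?thesis by (simp add: algebra_simps)
  qed
  moreover have "(\<lambda>n. of_real c * (of_real (binc (c + 1) n) * fps_nth E n * z ^ n)) sums (of_real c * H (c + 1) z)"
    using c by (intro sums_mult binc_mult_sums z) auto
  ultimately show ?thesis by (simp only: sums_unique2)
qed

text \<open>The phase \<kappa> disappears from both conclusions: the form is multiplied by
  |\<kappa>|^2 = 1, and the quotient is unchanged when both terms are multiplied by \<kappa>, which
  makes its denominator real and nonnegative.\<close>

lemma binc_mult_step:
  assumes b: "b \<ge> 0" and s: "0 \<le> s" "s \<le> 1" "b + s > 0"
    and nz: "\<And>z. z \<in> ball 0 1 \<Longrightarrow> H (b + s) z \<noteq> 0"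
    and re: "\<And>z. z \<in> ball 0 1 \<Longrightarrow> Re (z * deriv (H (b + s)) z / H (b + s) z) \<ge> - (b + s) / 2"
    and z: "z \<in> ball 0 1"
  shows "0 \<le> Re ((2 * H (b + 1) z - H b z) * cnj (H b z))" "0 \<le> Re (H b z / H (b + s) z)"
proof -
  have a0: "b + s \<ge> 0" using s by simp
  obtain \<rho> \<kappa> where \<rho>: "0 \<le> \<rho>" "\<rho> < 1" and \<kappa>: "norm \<kappa> = 1"
    and hull: "conic_hull (vdisc \<rho>) (b + s) (\<lambda>n. \<kappa> * (fps_nth (fps_expansion (H (b + s)) 0) n * z ^ n))"
    using conic_hull_if_log_deriv[OF binc_mult_holomorphic[OF a0] nz binc_mult_0 re z] by blast
  let ?\<phi> = "\<lambda>n. \<kappa> * (of_real (binc (b + s) n) * fps_nth E n * z ^ n)"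
  have hull: "conic_hull (vdisc \<rho>) (b + s) ?\<phi>" using hull by (simp add: binc_mult_expansion[OF a0])
  have bp: "binc (b + s) n \<noteq> 0" for n using s(3) pochhammer_pos[of "b + s" n] by (simp add: binc_def)
  have z1: "norm z < 1" using z by simp
  have sm: "(\<lambda>n. of_real (binc c n / binc (b + s) n) * ?\<phi> n) sums (\<kappa> * H c z)" if "c \<ge> 0" for c
  proof -
    have "of_real (binc c n / binc (b + s) n) * ?\<phi> n = \<kappa> * (of_real (binc c n) * fps_nth E n * z ^ n)" for n
      using bp[of n] by (simp add: field_simps)
    thus ?thesis using sums_mult[OF binc_mult_sums[OF that z1], of \<kappa>] by simp
  qed
  have Y: "?\<phi> sums (\<kappa> * H (b + s) z)" by (intro sums_mult binc_mult_sums a0 z1)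
  note q = conic_hull_quadratic[OF \<rho> b s hull sm[OF b] sm Y]
  have "0 \<le> Re ((2 * (\<kappa> * H (b + 1) z) - \<kappa> * H b z) * cnj (\<kappa> * H b z))" using b by (intro q(1)) auto
  also have "(2 * (\<kappa> * H (b + 1) z) - \<kappa> * H b z) * cnj (\<kappa> * H b z)
      = (\<kappa> * cnj \<kappa>) * ((2 * H (b + 1) z - H b z) * cnj (H b z))" by (simp add: algebra_simps)
  also have "\<kappa> * cnj \<kappa> = 1" using \<kappa> by (simp add: complex_norm_square[symmetric])
  finally show "0 \<le> Re ((2 * H (b + 1) z - H b z) * cnj (H b z))" by simp
  have Im0: "Im (\<kappa> * H (b + s) z) = 0" and Re0: "0 \<le> Re (\<kappa> * H (b + s) z)" and X: "0 \<le> Re (\<kappa> * H b z)"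
    using q(2-4) b by auto
  have "H b z / H (b + s) z = (\<kappa> * H b z) / (\<kappa> * H (b + s) z)" using \<kappa> by auto
  also have "\<kappa> * H (b + s) z = of_real (Re (\<kappa> * H (b + s) z))" using Im0 by (simp add: complex_eq_iff)
  also have "Re (\<kappa> * H b z / of_real (Re (\<kappa> * H (b + s) z))) = Re (\<kappa> * H b z) / Re (\<kappa> * H (b + s) z)" by simp
  also have "\<dots> \<ge> 0" using X Re0 by simp
  finally show "0 \<le> Re (H b z / H (b + s) z)" .
qed

lemma binc_mult_step_log_deriv:
  assumes b: "b > 0" and s: "0 \<le> s" "s \<le> 1"
    and nz: "\<And>z. z \<in> ball 0 1 \<Longrightarrow> H (b + s) z \<noteq> 0"
    and re: "\<And>z. z \<in> ball 0 1 \<Longrightarrow> Re (z * deriv (H (b + s)) z / H (b + s) z) \<ge> - (b + s) / 2"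
    and z: "z \<in> ball 0 1"
  shows "H b z \<noteq> 0" "Re (z * deriv (H b) z / H b z) \<ge> - b / 2"
proof -
  have bs: "b \<ge> 0" "b + s \<ge> 0" "b + s > 0" using b s by auto
  have step: "0 \<le> Re ((2 * H (b + 1) w - H b w) * cnj (H b w))" "0 \<le> Re (H b w / H (b + s) w)"
    if "w \<in> ball 0 1" for w
    using binc_mult_step[OF bs(1) s bs(3) _ _ that] nz re by blast+
  \<comment> \<open>A zero of H_b would be compatible with the bound on the form. It is excluded by
    this quotient, which has nonnegative real part and equals 1 at 0.\<close>
  have "(\<lambda>z. H b z / H (b + s) z) holomorphic_on ball 0 1"
    using nz bs by (intro holomorphic_intros binc_mult_holomorphic) auto
  hence "Re (H b z / H (b + s) z) > 0"
    by (rule Re_greater_if_Re_ge) (use step(2) z in \<open>auto simp: binc_mult_0\<close>)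
  thus nz': "H b z \<noteq> 0" by auto
  have zd: "z * deriv (H b) z = of_real b * (H (b + 1) z - H b z)"
    using binc_mult_Suc[OF bs(1), of z] z by (simp add: algebra_simps)
  hence "of_real 2 * (z * deriv (H b) z / H b z) + of_real b = of_real b * ((2 * H (b + 1) z - H b z) / H b z)"
    unfolding zd using nz' by (simp add: field_simps)
  also have "(2 * H (b + 1) z - H b z) / H b z = (2 * H (b + 1) z - H b z) * cnj (H b z) / of_real ((norm (H b z))\<^sup>2)"
    by (rule complex_div_cnj)
  finally have "Re (of_real 2 * (z * deriv (H b) z / H b z) + of_real b)
      = b * (Re ((2 * H (b + 1) z - H b z) * cnj (H b z)) / (norm (H b z))\<^sup>2)"
    by (simp only: Re_complex_of_real Re_divide_of_real times_complex.sel Im_complex_of_real)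
  also have "\<dots> \<ge> 0" using step(1)[OF z] b by (intro mult_nonneg_nonneg divide_nonneg_nonneg) auto
  finally have "0 \<le> Re (of_real 2 * (z * deriv (H b) z / H b z) + of_real b)" .
  moreover have "Re (of_real 2 * w + of_real b) = 2 * Re w + b" for w by simp
  ultimately have "0 \<le> 2 * Re (z * deriv (H b) z / H b z) + b" by (simp only:)
  thus "Re (z * deriv (H b) z / H b z) \<ge> - b / 2" by simp
qed

end

section \<open>Inclusion of the prestarlike classes\<close>

definition quot_fps :: "(complex \<Rightarrow> complex) \<Rightarrow> complex fps" where
  "quot_fps f = fps_shift 1 (fps_expansion f 0)"

text \<open>The function H_c attached to f: on the disc, for f in \<open>class_A\<close>, c = 1
  gives back f(z)/z and c = 0 the constant 1.\<close>

definition quot_mult :: "(complex \<Rightarrow> complex) \<Rightarrow> real \<Rightarrow> complex \<Rightarrow> complex" where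
  "quot_mult f c = eval_fps (binc_mult c (quot_fps f))"

section \<open>Translation of the classes into conditions on the multipliers\<close>

lemma class_A_D:
  assumes "f \<in> class_A"
  shows "f holomorphic_on ball 0 1" "f 0 = 0" "deriv f 0 = 1" "f has_fps_expansion fps_expansion f 0"
proof -
  show "f holomorphic_on ball 0 1" "f 0 = 0" "deriv f 0 = 1" using assms by (auto simp: class_A_def)
  thus "f has_fps_expansion fps_expansion f 0" by (intro has_fps_expansion_fps_expansion[of "ball 0 1"]) auto
qed

lemma eball_1: "eball (0::complex) 1 = ball 0 1"
  by (auto simp: in_eball_iff)

lemma quot_fps_class_A:
  assumes f: "f \<in> class_A"
  shows "fps_conv_radius (quot_fps f) \<ge> 1" "fps_nth (quot_fps f) 0 = 1"
    "\<And>z. norm z < 1 \<Longrightarrow> f z = z * eval_fps (quot_fps f) z"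
proof -
  note D = class_A_D[OF f]
  show R: "fps_conv_radius (quot_fps f) \<ge> 1"
    unfolding quot_fps_def fps_conv_radius_shift
    by (rule holomorphic_on_imp_fps_conv_radius_ge[OF D(4)]) (use D(1) in \<open>simp add: eball_1\<close>)
  show "fps_nth (quot_fps f) 0 = 1" using D(3) by (simp add: quot_fps_def fps_expansion_def)
  fix z :: complex assume z: "norm z < 1"
  have "fps_expansion f 0 = fps_X * quot_fps f"
    by (rule fps_ext) (auto simp: quot_fps_def fps_expansion_def D(2))
  moreover have "eval_fps (fps_expansion f 0) z = f z"
    using D(4) z D(1) by (rule has_fps_expansion_imp_eval_fps_eq)
  ultimately show "f z = z * eval_fps (quot_fps f) z"
    using less_fps_conv_radius[OF R z] by (simp add: eval_fps_mult)
qed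

lemma quot_mult_holomorphic: "f \<in> class_A \<Longrightarrow> c \<ge> 0 \<Longrightarrow> quot_mult f c holomorphic_on ball 0 1"
  unfolding quot_mult_def by (rule binc_mult_holomorphic[OF quot_fps_class_A(1,2)])

lemma quot_mult_0: "f \<in> class_A \<Longrightarrow> quot_mult f c 0 = 1"
  unfolding quot_mult_def by (rule binc_mult_0[OF quot_fps_class_A(1,2)])

lemma quot_mult_1: "quot_mult f 1 = eval_fps (quot_fps f)"
proof -
  have "binc 1 n = 1" for n by (simp add: binc_def pochhammer_fact[symmetric])
  hence "binc_mult 1 (quot_fps f) = quot_fps f" by (intro fps_ext) simp
  thus ?thesis by (simp add: quot_mult_def)
qed

lemma quot_mult_0_eq_1: "f \<in> class_A \<Longrightarrow> quot_mult f 0 z = 1"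
proof -
  assume f: "f \<in> class_A"
  have "binc 0 n = (if n = 0 then 1 else 0)" for n by (simp add: binc_def pochhammer_0_left)
  hence "binc_mult 0 (quot_fps f) = 1" using quot_fps_class_A(2)[OF f] by (intro fps_ext) (auto simp: fps_one_nth)
  thus ?thesis by (simp add: quot_mult_def)
qed

lemma quot_z_eq:
  assumes f: "f \<in> class_A" and z: "norm z < 1"
  shows "quot_z f z = quot_mult f 1 z"
proof (cases "z = 0")
  case True
  have "(f has_field_derivative deriv f 0) (at 0)"
    using class_A_D(1)[OF f] by (intro holomorphic_derivI[of _ "ball 0 1"]) auto
  hence "((\<lambda>z. f z / z) \<longlongrightarrow> 1) (at 0)"
    using class_A_D(2,3)[OF f] by (simp add: has_field_derivative_iff)
  hence "Lim (at 0) (\<lambda>z. f z / z) = 1" by (intro tendsto_Lim) auto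
  thus ?thesis using True quot_mult_0[OF f] by (simp add: quot_z_def ext0_def)
qed (use quot_fps_class_A(3)[OF f z] in \<open>simp add: quot_z_def ext0_def quot_mult_1\<close>)

lemma one_minus_powr_expansion:
  "(\<lambda>z::complex. (1 - z) powr (- of_real b)) has_fps_expansion Abs_fps (\<lambda>n. of_real (binc b n))"
proof (rule has_fps_expansionI)
  have "eventually (\<lambda>z. z \<in> ball (0::complex) 1) (nhds 0)"
    by (rule eventually_nhds_in_open) auto
  thus "eventually (\<lambda>z. (\<lambda>n. fps_nth (Abs_fps (\<lambda>n. of_real (binc b n))) n * z ^ n) sums (1 - z) powr (- of_real b)) (nhds (0::complex))"
    by eventually_elim (use binc_sums in auto)
qed

lemma hadamard_powr:
  assumes f: "f \<in> class_A" and b: "b \<ge> 0" and z: "norm z < 1"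
  shows "hadamard f (\<lambda>z. z / (1 - z) powr (of_real b)) z = z * quot_mult f b z"
proof -
  have "(\<lambda>z::complex. z * (1 - z) powr (- of_real b)) has_fps_expansion fps_X * Abs_fps (\<lambda>n. of_real (binc b n))"
    by (intro has_fps_expansion_mult has_fps_expansion_fps_X one_minus_powr_expansion)
  moreover have "(\<lambda>z::complex. z / (1 - z) powr (of_real b)) = (\<lambda>z. z * (1 - z) powr (- of_real b))"
    by (simp add: powr_minus divide_inverse)
  ultimately have "fps_expansion (\<lambda>z::complex. z / (1 - z) powr (of_real b)) 0 = fps_X * Abs_fps (\<lambda>n. of_real (binc b n))"
    using fps_expansion_eqI by simp
  hence "hadamard f (\<lambda>z. z / (1 - z) powr (of_real b)) z
      = eval_fps (Abs_fps (\<lambda>n. fps_nth (fps_expansion f 0) n * fps_nth (fps_X * Abs_fps (\<lambda>n. of_real (binc b n))) n)) z"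
    by (simp add: hadamard_def)
  also have "Abs_fps (\<lambda>n. fps_nth (fps_expansion f 0) n * fps_nth (fps_X * Abs_fps (\<lambda>n. of_real (binc b n))) n)
      = fps_X * binc_mult b (quot_fps f)"
    by (rule fps_ext) (auto simp: quot_fps_def)
  also have "eval_fps \<dots> z = z * quot_mult f b z"
    unfolding quot_mult_def using less_fps_conv_radius[OF fps_conv_radius_binc_mult[OF quot_fps_class_A(1)[OF f] b] z]
    by (simp add: eval_fps_mult)
  finally show ?thesis .
qed

lemma deriv_eq_if_eq_on_ball:
  fixes g k :: "complex \<Rightarrow> complex"
  assumes "\<And>w. norm w < 1 \<Longrightarrow> g w = k w" "norm z < 1"
  shows "deriv g z = deriv k z"
proof (rule deriv_cong_ev[OF _ refl])
  have "eventually (\<lambda>w. w \<in> ball (0::complex) 1) (nhds z)"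
    using assms(2) by (intro eventually_nhds_in_open) auto
  thus "eventually (\<lambda>w. g w = k w) (nhds z)" by eventually_elim (use assms(1) in auto)
qed

text \<open>For g = z Q one has z g'/g = 1 + z Q'/Q, which removes the singularity at 0. The
  extended quotient is 1 there, so \<alpha> <= 1 makes the condition at 0 hold on both
  sides.\<close>

lemma starlike_order_iff:
  assumes Q: "Q holomorphic_on ball 0 1" and Q0: "Q 0 = 1" and g: "\<And>z. norm z < 1 \<Longrightarrow> g z = z * Q z" and \<alpha>: "\<alpha> \<le> 1"
  shows "g \<in> starlike_order \<alpha> \<longleftrightarrow> (\<forall>z\<in>ball 0 1. Q z \<noteq> 0 \<and> Re (z * deriv Q z / Q z) \<ge> \<alpha> - 1)"
proof -
  have dQ: "(Q has_field_derivative deriv Q z) (at z)" if "norm z < 1" for z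
    using Q that by (intro holomorphic_derivI[of _ "ball 0 1"]) auto
  have dg: "deriv g z = Q z + z * deriv Q z" if z: "norm z < 1" for z
  proof -
    have "((\<lambda>z. z * Q z) has_field_derivative (Q z + z * deriv Q z)) (at z)"
      by (auto intro!: derivative_eq_intros dQ z)
    hence "deriv (\<lambda>z. z * Q z) z = Q z + z * deriv Q z" by (rule DERIV_imp_deriv)
    thus ?thesis using deriv_eq_if_eq_on_ball[of g "\<lambda>z. z * Q z" z] g z by simp
  qed
  have "g holomorphic_on ball 0 1"
    by (rule holomorphic_transform[of "\<lambda>z. z * Q z"]) (use g in \<open>auto intro!: holomorphic_intros Q\<close>)
  hence gA: "g \<in> class_A" using g[of 0] dg[of 0] Q0 by (simp add: class_A_def)
  have quot: "z * deriv g z / g z = 1 + z * deriv Q z / Q z" if "norm z < 1" "z \<noteq> 0" "Q z \<noteq> 0" for z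
    using that g[of z] dg[of z] by (simp add: field_simps)
  have at0: "ext0 (\<lambda>w. w * deriv g w / g w) 0 = 1"
  proof -
    have cont: "isCont Q 0" using dQ[of 0] by (simp add: DERIV_isCont)
    have "deriv Q holomorphic_on ball 0 1" using Q by (intro holomorphic_deriv) auto
    hence "isCont (deriv Q) 0"
      using holomorphic_on_imp_continuous_on continuous_on_eq_continuous_at[of "ball 0 1"] by fastforce
    hence "isCont (\<lambda>z. 1 + z * deriv Q z / Q z) 0" using cont Q0 by (intro continuous_intros) auto
    hence "((\<lambda>z. 1 + z * deriv Q z / Q z) \<longlongrightarrow> 1) (at 0)" by (simp add: isCont_def)
    moreover have "eventually (\<lambda>z. 1 + z * deriv Q z / Q z = z * deriv g z / g z) (at 0)"
    proof -
      have "(Q \<longlongrightarrow> 1) (at 0)" using cont Q0 by (simp add: isCont_def)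
      hence "eventually (\<lambda>z. Q z \<noteq> 0) (at 0)" by (rule tendsto_imp_eventually_ne) simp
      moreover have "eventually (\<lambda>z. z \<in> ball (0::complex) 1 - {0}) (at 0)"
        by (rule eventually_at_in_open) auto
      ultimately show ?thesis by eventually_elim (use quot in simp)
    qed
    ultimately have "((\<lambda>z. z * deriv g z / g z) \<longlongrightarrow> 1) (at 0)" by (rule Lim_transform_eventually)
    hence "Lim (at 0) (\<lambda>z. z * deriv g z / g z) = 1" by (intro tendsto_Lim) auto
    thus ?thesis by (simp add: ext0_def)
  qed
  have nz: "(\<forall>z\<in>ball 0 1 - {0}. g z \<noteq> 0) \<longleftrightarrow> (\<forall>z\<in>ball 0 1. Q z \<noteq> 0)"
    using g Q0 by (metis Diff_iff insert_iff mem_ball_0 mult_eq_0_iff empty_iff zero_neq_one)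
  have "Re (ext0 (\<lambda>w. w * deriv g w / g w) z) \<ge> \<alpha> \<longleftrightarrow> Re (z * deriv Q z / Q z) \<ge> \<alpha> - 1"
    if "z \<in> ball 0 1" "Q z \<noteq> 0" for z
  proof (cases "z = 0")
    case True
    thus ?thesis using at0 \<alpha> by simp
  next
    case False
    have "Re (1 + w) = 1 + Re w" for w by simp
    thus ?thesis using quot[of z] that False by (simp add: ext0_def del: plus_complex.sel) linarith
  qed
  thus ?thesis unfolding starlike_order_def using gA nz by auto
qed

lemma prestarlike_iff:
  assumes \<alpha>: "0 \<le> \<alpha>" "\<alpha> < 1"
  shows "f \<in> prestarlike \<alpha> \<longleftrightarrow> f \<in> class_A \<and> (\<forall>z\<in>ball 0 1. quot_mult f (2 - 2 * \<alpha>) z \<noteq> 0 \<and>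
     Re (z * deriv (quot_mult f (2 - 2 * \<alpha>)) z / quot_mult f (2 - 2 * \<alpha>) z) \<ge> - (2 - 2 * \<alpha>) / 2)"
proof (cases "f \<in> class_A")
  case True
  have b: "2 - 2 * \<alpha> \<ge> 0" using \<alpha> by simp
  have "hadamard f (\<lambda>z. z / (1 - z) powr of_real (2 - 2 * \<alpha>)) \<in> starlike_order \<alpha> \<longleftrightarrow>
      (\<forall>z\<in>ball 0 1. quot_mult f (2 - 2 * \<alpha>) z \<noteq> 0 \<and>
     Re (z * deriv (quot_mult f (2 - 2 * \<alpha>)) z / quot_mult f (2 - 2 * \<alpha>) z) \<ge> \<alpha> - 1)"
    by (rule starlike_order_iff) (use \<alpha> b True in \<open>auto intro: quot_mult_holomorphic quot_mult_0 hadamard_powr simp del: of_real_diff\<close>)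
  moreover have "f \<in> prestarlike \<alpha> \<longleftrightarrow> hadamard f (\<lambda>z. z / (1 - z) powr of_real (2 - 2 * \<alpha>)) \<in> starlike_order \<alpha>"
    using True \<alpha> by (simp add: prestarlike_def)
  moreover have e: "- (2 - 2 * \<alpha>) / 2 = \<alpha> - 1" by simp
  ultimately show ?thesis unfolding e using True by blast
qed (use \<alpha> in \<open>simp add: prestarlike_def\<close>)

lemma prestarlike_1_iff:
  "f \<in> prestarlike 1 \<longleftrightarrow> f \<in> class_A \<and> (\<forall>z\<in>ball 0 1. Re (quot_mult f 1 z) > 1/2)"
proof (cases "f \<in> class_A")
  case True
  have "f z / z = quot_mult f 1 z" if "z \<in> ball 0 1 - {0}" for z
    using quot_fps_class_A(3)[OF True, of z] that by (simp add: quot_mult_1)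
  moreover have "Re (quot_mult f 1 0) > 1/2" using quot_mult_0[OF True] by simp
  ultimately show ?thesis using True by (auto simp: prestarlike_def)
qed (simp add: prestarlike_def)

lemma prestarlike_mono_step:
  assumes \<alpha>: "0 \<le> \<alpha>" "\<alpha> \<le> \<beta>" "\<beta> < 1" "\<beta> \<le> \<alpha> + 1/2"
  shows "prestarlike \<alpha> \<subseteq> prestarlike \<beta>"
proof
  fix f assume "f \<in> prestarlike \<alpha>"
  moreover have \<alpha>1: "\<alpha> < 1" using \<alpha> by simp
  ultimately have f: "f \<in> class_A" and D: "\<forall>z\<in>ball 0 1. quot_mult f (2 - 2 * \<alpha>) z \<noteq> 0 \<and>
     Re (z * deriv (quot_mult f (2 - 2 * \<alpha>)) z / quot_mult f (2 - 2 * \<alpha>) z) \<ge> - (2 - 2 * \<alpha>) / 2"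
    using prestarlike_iff[OF \<alpha>(1) \<alpha>1] by auto
  define b where "b = 2 - 2 * \<beta>"
  \<comment> \<open>The orders of the multipliers differ by twice \<beta> - \<alpha>, so s <= 1
    limits a single step to length 1/2.\<close>
  define s where "s = 2 * (\<beta> - \<alpha>)"
  have a: "2 - 2 * \<alpha> = b + s" by (simp add: b_def s_def)
  have "b > 0" "0 \<le> s" "s \<le> 1" using \<alpha> by (auto simp: b_def s_def)
  note step = binc_mult_step_log_deriv[OF quot_fps_class_A(1,2)[OF f], folded quot_mult_def, OF this]
  have "\<forall>z\<in>ball 0 1. quot_mult f b z \<noteq> 0 \<and> Re (z * deriv (quot_mult f b) z / quot_mult f b z) \<ge> - b / 2"
    using step D unfolding a by blast
  thus "f \<in> prestarlike \<beta>"
    using f \<alpha> prestarlike_iff[of \<beta> f] unfolding b_def by simp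
qed

text \<open>The case b = 0 of the step: H_0 = 1, so the form is 2 H_1 - 1. Here s = 2 - 2 \<alpha>,
  and s <= 1 explains the restriction to \<alpha> >= 1/2.\<close>

lemma prestarlike_subset_1:
  assumes \<alpha>: "1/2 \<le> \<alpha>" "\<alpha> < 1"
  shows "prestarlike \<alpha> \<subseteq> prestarlike 1"
proof
  fix f assume "f \<in> prestarlike \<alpha>"
  moreover have "0 \<le> \<alpha>" using \<alpha> by simp
  ultimately have f: "f \<in> class_A" and D: "\<forall>z\<in>ball 0 1. quot_mult f (2 - 2 * \<alpha>) z \<noteq> 0 \<and>
     Re (z * deriv (quot_mult f (2 - 2 * \<alpha>)) z / quot_mult f (2 - 2 * \<alpha>) z) \<ge> - (2 - 2 * \<alpha>) / 2"
    using prestarlike_iff[OF _ \<alpha>(2)] by auto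
  define s where "s = 2 - 2 * \<alpha>"
  have s: "0 \<le> s" "s \<le> 1" "0 + s > 0" using \<alpha> by (auto simp: s_def)
  have ge: "Re (quot_mult f 1 z) \<ge> 1/2" if z: "z \<in> ball 0 1" for z
  proof -
    have "0 \<le> Re ((2 * quot_mult f (0 + 1) z - quot_mult f 0 z) * cnj (quot_mult f 0 z))"
      by (rule binc_mult_step(1)[OF quot_fps_class_A(1,2)[OF f], folded quot_mult_def, OF order_refl s _ _ z]) (use D in \<open>simp_all add: s_def\<close>)
    thus ?thesis by (simp add: quot_mult_0_eq_1[OF f])
  qed
  have "Re (quot_mult f 1 z) > 1/2" if z: "z \<in> ball 0 1" for z
    by (rule Re_greater_if_Re_ge[OF _ ge _ z]) (use quot_mult_0[OF f] quot_mult_holomorphic[OF f] in auto)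
  thus "f \<in> prestarlike 1" using f by (simp add: prestarlike_1_iff)
qed

lemma prestarlike_mono:
  assumes \<alpha>: "0 \<le> \<alpha>" "\<alpha> \<le> \<beta>" "\<beta> \<le> 1"
  shows "prestarlike \<alpha> \<subseteq> prestarlike \<beta>"
proof (cases "\<beta> < 1")
  case True
  \<comment> \<open>The orders differ by less than 1, so two steps through the midpoint
    suffice.\<close>
  define \<gamma> where "\<gamma> = (\<alpha> + \<beta>) / 2"
  have "0 \<le> \<gamma>" "\<alpha> \<le> \<gamma>" "\<gamma> < 1" "\<gamma> \<le> \<alpha> + 1/2" "\<gamma> \<le> \<beta>" "\<beta> \<le> \<gamma> + 1/2"
    using \<alpha> True by (simp_all add: \<gamma>_def field_simps)
  thus ?thesis using prestarlike_mono_step[of \<alpha> \<gamma>] prestarlike_mono_step[of \<gamma> \<beta>] \<alpha>(1) True by blast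
next
  case False
  hence \<beta>: "\<beta> = 1" using \<alpha> by simp
  show ?thesis
  proof (cases "\<alpha> < 1")
    case True
    \<comment> \<open>Orders below 1/2 first move up to 1/2, from where R_1 is one step
      away.\<close>
    define \<gamma> where "\<gamma> = max \<alpha> (1/2)"
    have "\<alpha> \<le> \<gamma>" "\<gamma> < 1" "\<gamma> \<le> \<alpha> + 1/2" "1/2 \<le> \<gamma>"
      using \<alpha> True by (simp_all add: \<gamma>_def field_simps)
    thus ?thesis using prestarlike_mono_step[of \<alpha> \<gamma>] prestarlike_subset_1[of \<gamma>] \<alpha>(1) \<beta> by blast
  qed (use \<alpha> \<beta> in auto)
qed

section \<open>Extremal functions\<close>

lemma quadratic_quot_mult:
  fixes c :: complex
  defines "f \<equiv> \<lambda>z. z + c * z ^ 2"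
  shows "f \<in> class_A" "quot_mult f b z = 1 + of_real b * c * z"
proof -
  have "f has_fps_expansion fps_X + fps_const c * fps_X ^ 2"
    unfolding f_def by (intro fps_expansion_intros)
  hence exp: "fps_expansion f 0 = fps_X + fps_const c * fps_X ^ 2" by (rule fps_expansion_eqI)
  have "deriv f 0 = fps_nth (fps_expansion f 0) 1" by (simp add: fps_expansion_def)
  hence "deriv f 0 = 1" by (simp add: exp)
  moreover have "f holomorphic_on ball 0 1" unfolding f_def by (intro holomorphic_intros)
  ultimately show "f \<in> class_A" by (simp add: class_A_def f_def)
  have nth: "fps_nth (quot_fps f) n = (if n = 0 then 1 else if n = 1 then c else 0)" for n
    by (auto simp: quot_fps_def exp fps_X_power_nth)
  have "quot_mult f b z = (\<Sum>n\<in>{0,1}. of_real (binc b n) * fps_nth (quot_fps f) n * z ^ n)"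
    unfolding quot_mult_def eval_fps_def binc_mult_nth by (rule suminf_finite) (auto simp: nth)
  thus "quot_mult f b z = 1 + of_real b * c * z" by (simp add: nth binc_def)
qed

lemma Re_inverse_one_minus_gt:
  assumes "norm z < 1"
  shows "Re (1 / (1 - z)) > 1/2"
proof -
  have nz: "1 - z \<noteq> 0" using assms by auto
  have "(norm z)\<^sup>2 < 1" using assms by (simp add: power_less_one_iff)
  moreover have "(norm z)\<^sup>2 = 1 - 2 * Re (1 - z) + (norm (1 - z))\<^sup>2"
    unfolding cmod_power2 by (simp add: power2_eq_square algebra_simps)
  ultimately have "(norm (1 - z))\<^sup>2 < 2 * Re (1 - z)" by linarith
  moreover have "(norm (1 - z))\<^sup>2 > 0" using nz by simp
  ultimately have "1/2 < Re (1 - z) / (norm (1 - z))\<^sup>2" by (simp only: pos_less_divide_eq)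
  also have "\<dots> = Re (1 / (1 - z))" by (simp add: Re_divide' cmod_power2)
  finally show ?thesis .
qed

lemma half_plane_map:
  defines "k \<equiv> \<lambda>z::complex. z / (1 - z)"
  shows "k \<in> class_A" "norm z < 1 \<Longrightarrow> quot_mult k b z = (1 - z) powr (- of_real b)"
proof -
  have b1: "binc 1 n = 1" for n by (simp add: binc_def pochhammer_fact[symmetric])
  have "(\<lambda>z::complex. z * (1 - z) powr (- of_real 1)) has_fps_expansion fps_X * Abs_fps (\<lambda>n. of_real (binc 1 n))"
    by (intro has_fps_expansion_mult has_fps_expansion_fps_X one_minus_powr_expansion)
  also have "(\<lambda>z::complex. z * (1 - z) powr (- of_real 1)) = k"
    by (simp add: k_def powr_minus divide_inverse)
  finally have exp: "fps_expansion k 0 = fps_X * Abs_fps (\<lambda>n. 1)"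
    unfolding b1 of_real_1 by (rule fps_expansion_eqI)
  have "deriv k 0 = fps_nth (fps_expansion k 0) 1" by (simp add: fps_expansion_def)
  hence "deriv k 0 = 1" by (simp add: exp)
  moreover have "k holomorphic_on ball 0 1" unfolding k_def by (intro holomorphic_intros) auto
  ultimately show "k \<in> class_A" by (simp add: class_A_def k_def)
  assume z: "norm z < 1"
  have "fps_nth (quot_fps k) n = 1" for n by (simp add: quot_fps_def exp)
  thus "quot_mult k b z = (1 - z) powr (- of_real b)"
    using binc_sums[OF z, of b] by (simp add: quot_mult_def eval_fps_def sums_iff)
qed

text \<open>By monotonicity only the smallest class matters. All coefficients of z/(1 - z) are 1, so
  H_2 = (1 - z)^(-2) and z H_2'/H_2 = 2 (1/(1 - z) - 1), where Re (1/(1 - z)) > 1/2. As a member of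
  every class, the function determines both K and B.\<close>

lemma half_plane_map_in_prestarlike:
  assumes "0 \<le> \<alpha>" "\<alpha> \<le> 1"
  shows "(\<lambda>z. z / (1 - z)) \<in> prestarlike \<alpha>"
proof -
  let ?k = "\<lambda>z::complex. z / (1 - z)"
  have "quot_mult ?k 2 z \<noteq> 0 \<and> Re (z * deriv (quot_mult ?k 2) z / quot_mult ?k 2 z) \<ge> - 2 / 2"
    if z: "z \<in> ball 0 1" for z
  proof -
    have z1: "norm z < 1" "1 - z \<noteq> 0" using z by auto
    have nz: "quot_mult ?k 2 z \<noteq> 0" using z1 half_plane_map(2)[OF z1(1), of 2] by simp
    have "quot_mult ?k (2 + 1) z = (1 - z) powr (- of_real 2 + (- 1))"
      using half_plane_map(2)[OF z1(1), of "2 + 1"] by simp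
    also have "\<dots> = (1 - z) powr (- of_real 2) * (1 - z) powr (- 1)" by (rule powr_add)
    also have "\<dots> = quot_mult ?k 2 z * (1 / (1 - z))"
      using z1 half_plane_map(2)[OF z1(1), of 2] by (simp add: powr_minus divide_inverse)
    finally have S: "quot_mult ?k (2 + 1) z = quot_mult ?k 2 z * (1 / (1 - z))" .
    have "z * deriv (quot_mult ?k 2) z + of_real 2 * quot_mult ?k 2 z = of_real 2 * quot_mult ?k (2 + 1) z"
      using binc_mult_Suc[OF quot_fps_class_A(1,2)[OF half_plane_map(1)], folded quot_mult_def, of 2 z] z1 by simp
    hence "z * deriv (quot_mult ?k 2) z = of_real 2 * (quot_mult ?k 2 z * (1 / (1 - z) - 1))"
      unfolding S by (simp add: algebra_simps)
    hence "z * deriv (quot_mult ?k 2) z / quot_mult ?k 2 z = of_real 2 * (1 / (1 - z) - 1)"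
      using nz by simp
    moreover have "Re (of_real 2 * (w - 1)) = 2 * (Re w - 1)" for w by simp
    ultimately have "Re (z * deriv (quot_mult ?k 2) z / quot_mult ?k 2 z) = 2 * (Re (1 / (1 - z)) - 1)"
      by (simp only:)
    thus ?thesis using nz Re_inverse_one_minus_gt[OF z1(1)] by simp
  qed
  hence "?k \<in> prestarlike 0" using prestarlike_iff[of 0 ?k] half_plane_map(1) by simp
  thus ?thesis using prestarlike_mono[of 0 \<alpha>] assms by auto
qed

text \<open>For \<alpha> < 1 and b = 2 - 2 \<alpha>, H_b is 1 + x z with x = (1 - \<alpha>)/(2 -
  \<alpha>). The real part of x z/(1 + x z) = 1 - 1/(1 + x z) is least in the limit z -> -1, where
  it becomes 1 - 1/(1 - x) = \<alpha> - 1. So the coefficient is the one for which the bound is just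
  reached.\<close>

lemma quadratic_in_prestarlike:
  assumes \<alpha>: "0 < \<alpha>" "\<alpha> \<le> 1"
  shows "(\<lambda>z. z + 1 / (2 * (2 - of_real \<alpha>)) * z ^ 2) \<in> prestarlike \<alpha>"
proof -
  define c where "c = 1 / (2 * (2 - \<alpha>))"
  let ?f = "\<lambda>z::complex. z + of_real c * z ^ 2"
  have f: "?f \<in> class_A" and Q: "\<And>b z. quot_mult ?f b z = 1 + of_real b * of_real c * z"
    using quadratic_quot_mult[of "of_real c"] by auto
  have "?f \<in> prestarlike \<alpha>"
  proof (cases "\<alpha> = 1")
    case True
    have "Re (quot_mult ?f 1 z) > 1/2" if "z \<in> ball 0 1" for z
    proof -
      have "Re (quot_mult ?f 1 z) = 1 + c * Re z" unfolding Q by simp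
      also have "\<dots> > 1/2" using that abs_Re_le_cmod[of z] True by (simp add: c_def)
      finally show ?thesis .
    qed
    thus ?thesis using f True by (simp add: prestarlike_1_iff)
  next
    case False
    hence \<alpha>1: "\<alpha> < 1" using \<alpha> by simp
    define b where "b = 2 - 2 * \<alpha>"
    define x where "x = b * c"
    have x: "0 < x" "x < 1" "1 / (1 - x) = 2 - \<alpha>" "b > 0"
      using \<alpha> \<alpha>1 by (auto simp: x_def b_def c_def field_simps)
    have "quot_mult ?f b z \<noteq> 0 \<and> Re (z * deriv (quot_mult ?f b) z / quot_mult ?f b z) \<ge> - b / 2"
      if z: "z \<in> ball 0 1" for z
    proof -
      have Qb: "quot_mult ?f b = (\<lambda>z. 1 + of_real x * z)" by (auto simp: Q x_def)
      have D: "deriv (quot_mult ?f b) z = of_real x"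
        unfolding Qb by (rule DERIV_imp_deriv) (auto intro!: derivative_eq_intros)
      have "norm (of_real x * z) \<le> x" using z x by (simp add: norm_mult mult_left_le)
      moreover have "norm (1::complex) \<le> norm (1 + of_real x * z) + norm (of_real x * z)"
        using norm_triangle_ineq4[of "1 + of_real x * z" "of_real x * z"] by simp
      ultimately have w: "norm (1 + of_real x * z) \<ge> 1 - x" by simp
      hence nz: "1 + of_real x * z \<noteq> 0" using x by auto
      have "norm (1 / (1 + of_real x * z)) \<le> 1 / (1 - x)"
        unfolding norm_divide norm_one using w x by (intro frac_le) auto
      hence "Re (1 / (1 + of_real x * z)) \<le> 2 - \<alpha>"
        using complex_Re_le_cmod[of "1 / (1 + of_real x * z)"] x(3) by linarith
      moreover have "z * of_real x / (1 + of_real x * z) = 1 - 1 / (1 + of_real x * z)"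
        using nz by (simp add: field_simps)
      moreover have "Re (1 - w) = 1 - Re w" for w by simp
      ultimately have "Re (z * of_real x / (1 + of_real x * z)) \<ge> - b / 2"
        by (simp only: b_def) simp
      thus ?thesis using nz D Qb by simp
    qed
    thus ?thesis using f \<alpha> \<alpha>1 prestarlike_iff[of \<alpha> ?f] unfolding b_def by simp
  qed
  moreover have "?f = (\<lambda>z. z + 1 / (2 * (2 - of_real \<alpha>)) * z ^ 2)" by (simp add: c_def)
  ultimately show ?thesis by simp
qed

lemma quadratic_notin_prestarlike:
  assumes s: "0 \<le> s" "s < \<alpha>" "\<alpha> \<le> 1"
  shows "(\<lambda>z. z + 1 / (2 * (2 - of_real \<alpha>)) * z ^ 2) \<notin> prestarlike s"
proof
  define c where "c = 1 / (2 * (2 - \<alpha>))"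
  let ?f = "\<lambda>z::complex. z + of_real c * z ^ 2"
  assume "(\<lambda>z. z + 1 / (2 * (2 - of_real \<alpha>)) * z ^ 2) \<in> prestarlike s"
  moreover have "?f = (\<lambda>z. z + 1 / (2 * (2 - of_real \<alpha>)) * z ^ 2)" by (simp add: c_def)
  ultimately have "?f \<in> prestarlike s" by simp
  define b where "b = 2 - 2 * s"
  define x where "x = b * c"
  \<comment> \<open>At z = -t the bound of order s reads x t <= (1 - s)/(2 - s). Since x = (1 -
    s)/(2 - \<alpha>), it fails exactly for t > r, and s < \<alpha> leaves room between r and
    1.\<close>
  define r where "r = (2 - \<alpha>) / (2 - s)"
  define t where "t = (r + 1) / 2"
  have x: "0 < x" "x \<le> 1" using s by (auto simp: x_def b_def c_def field_simps)
  have "0 < r" "r < 1" using s by (auto simp: r_def)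
  hence t: "0 < t" "t < 1" "r < t" by (simp_all add: t_def)
  have "x * t \<le> 1 * t" using x t by (intro mult_right_mono) auto
  hence xt: "x * t < 1" using t(2) by linarith
  have Qb: "quot_mult ?f b = (\<lambda>z. 1 + of_real x * z)"
    using quadratic_quot_mult(2)[of "of_real c" b] by (auto simp: x_def)
  have D: "deriv (quot_mult ?f b) z = of_real x" for z
    unfolding Qb by (rule DERIV_imp_deriv) (auto intro!: derivative_eq_intros)
  have "of_real (-t) \<in> ball (0::complex) 1" using t by simp
  hence "Re (of_real (-t) * of_real x / (1 + of_real x * of_real (-t))) \<ge> - b / 2"
    using \<open>?f \<in> prestarlike s\<close> s prestarlike_iff[of s ?f] D Qb unfolding b_def[symmetric] by fastforce
  also have "of_real (-t) * of_real x / (1 + of_real x * of_real (-t)) = complex_of_real (- (x * t) / (1 - x * t))"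
    by simp
  finally have "- b / 2 \<le> - (x * t) / (1 - x * t)" by (simp only: Re_complex_of_real)
  moreover have "- b / 2 = - (1 - s)" by (simp add: b_def)
  ultimately have "x * t / (1 - x * t) \<le> 1 - s" by (simp only: minus_divide_left[symmetric] neg_le_iff_le)
  hence "x * t \<le> (1 - s) * (1 - x * t)" using xt by (simp add: pos_divide_le_eq)
  hence "x * t * (2 - s) \<le> 1 - s" by (simp add: algebra_simps)
  moreover have "x = (1 - s) / (2 - \<alpha>)" using s by (simp add: x_def b_def c_def field_simps)
  ultimately have "(1 - s) * (t * (2 - s)) \<le> (1 - s) * (2 - \<alpha>)" using s by (simp add: field_simps)
  hence "t * (2 - s) \<le> 2 - \<alpha>" using s by simp
  thus False using t(3) s by (simp add: r_def field_simps)
qed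

section \<open>The constants K and B\<close>

lemma prestarlike_Re_quot:
  assumes "0 \<le> \<alpha>" "\<alpha> \<le> 1" "f \<in> prestarlike \<alpha>" "z \<in> ball 0 1"
  shows "f \<in> class_A" "Re (quot_z f z) > 1/2"
proof -
  have "f \<in> prestarlike 1" using prestarlike_mono[of \<alpha> 1] assms by auto
  thus "f \<in> class_A" "Re (quot_z f z) > 1/2"
    using assms(4) by (auto simp: prestarlike_1_iff quot_z_eq)
qed

lemma quot_z_half_plane_map:
  assumes "norm z < 1"
  shows "quot_z (\<lambda>z. z / (1 - z)) z = 1 / (1 - z)"
proof -
  have "1 - z \<noteq> 0" using assms by auto
  thus ?thesis using quot_z_eq[OF half_plane_map(1) assms] half_plane_map(2)[OF assms, of 1]
    by (simp add: powr_minus divide_inverse)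
qed

lemma K_const_prestarlike:
  assumes \<alpha>: "0 \<le> \<alpha>" "\<alpha> \<le> 1"
  shows "K_const (prestarlike \<alpha>) = 1/2"
proof (rule antisym)
  let ?k = "\<lambda>z::complex. z / (1 - z)"
  let ?I = "\<lambda>f. INF z\<in>ball 0 1. Re (quot_z f z)"
  have Ige: "?I f \<ge> 1/2" if "f \<in> prestarlike \<alpha>" for f
    using prestarlike_Re_quot(2)[OF \<alpha> that] by (intro cINF_greatest) (auto intro: less_imp_le)
  have k: "?k \<in> prestarlike \<alpha>" by (rule half_plane_map_in_prestarlike[OF \<alpha>])
  thus "1/2 \<le> K_const (prestarlike \<alpha>)" unfolding K_const_def by (intro cINF_greatest Ige) auto
  \<comment> \<open>At z = -t the quotient of z/(1 - z) is 1/(1 + t), which tends to the lower bound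
    1/2 without reaching it.\<close>
  have le: "K_const (prestarlike \<alpha>) \<le> 1 / (1 + t)" if t: "0 < t" "t < 1" for t
  proof -
    have "K_const (prestarlike \<alpha>) \<le> ?I ?k"
      unfolding K_const_def by (intro cINF_lower bdd_belowI2[OF Ige] k)
    also have "?I ?k \<le> Re (quot_z ?k (of_real (- t)))"
      using t by (intro cINF_lower bdd_belowI2[OF less_imp_le[OF prestarlike_Re_quot(2)[OF \<alpha> k]]]) auto
    also have "quot_z ?k (of_real (- t)) = of_real (1 / (1 + t))"
      using t by (subst quot_z_half_plane_map) auto
    finally show ?thesis by simp
  qed
  have "((\<lambda>t::real. 1 / (1 + t)) \<longlongrightarrow> 1 / (1 + 1)) (at_left 1)" by (intro tendsto_intros) auto
  moreover have "eventually (\<lambda>t. K_const (prestarlike \<alpha>) \<le> 1 / (1 + t)) (at_left 1)"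
    using le by (subst eventually_at_left[of 0]) (auto intro!: exI[of _ 0])
  ultimately show "K_const (prestarlike \<alpha>) \<le> 1/2"
    by (intro tendsto_lowerbound[of _ "1/2" "at_left (1::real)"]) auto
qed

lemma B_const_prestarlike:
  assumes \<alpha>: "0 \<le> \<alpha>" "\<alpha> \<le> 1"
  shows "B_const (prestarlike \<alpha>) = 1"
proof -
  let ?k = "\<lambda>z::complex. z / (1 - z)"
  let ?S = "\<lambda>f. SUP z\<in>ball 0 1. \<bar>Arg (quot_z f z)\<bar>"
  let ?T = "SUP f\<in>prestarlike \<alpha>. ?S f"
  have Arg_le: "\<bar>Arg (quot_z f z)\<bar> \<le> pi/2" if "f \<in> prestarlike \<alpha>" "z \<in> ball 0 1" for f z
  proof -
    have "Re (quot_z f z) > 0" using prestarlike_Re_quot(2)[OF \<alpha> that] by simp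
    moreover from this have "quot_z f z \<noteq> 0" by auto
    ultimately show ?thesis using Re_Ln_pos_lt_imp[of "quot_z f z"] by (simp add: Arg_def)
  qed
  have Sle: "?S f \<le> pi/2" if "f \<in> prestarlike \<alpha>" for f
    using Arg_le[OF that] by (intro cSUP_least) auto
  have k: "?k \<in> prestarlike \<alpha>" by (rule half_plane_map_in_prestarlike[OF \<alpha>])
  have "?T = pi/2"
  proof (rule antisym)
    show "?T \<le> pi/2" using k by (intro cSUP_least Sle) auto
    have ge: "\<psi> \<le> ?T" if \<psi>: "0 < \<psi>" "\<psi> < pi/2" for \<psi>
    proof -
      have c: "cos \<psi> > 0" using \<psi> by (intro cos_gt_zero) auto
      \<comment> \<open>The point 1 - z lies on the circle with diameter [0, 1], at angle \<psi>.
        Then |z| = sin \<psi> < 1 and 1/(1 - z) has argument -\<psi>, so angles arbitrarily close to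
        pi/2 occur.\<close>
      define z where "z = 1 - of_real (cos \<psi>) * cis \<psi>"
      have "(norm z)\<^sup>2 = (1 - cos \<psi> * cos \<psi>)\<^sup>2 + (cos \<psi> * sin \<psi>)\<^sup>2"
        unfolding cmod_power2 z_def by simp
      also have "1 - cos \<psi> * cos \<psi> = (sin \<psi>)\<^sup>2"
        unfolding power2_eq_square[symmetric] by (rule sin_squared_eq[symmetric])
      also have "((sin \<psi>)\<^sup>2)\<^sup>2 + (cos \<psi> * sin \<psi>)\<^sup>2 = (sin \<psi>)\<^sup>2 * ((sin \<psi>)\<^sup>2 + (cos \<psi>)\<^sup>2)"
        by (simp only: power2_eq_square algebra_simps)
      also have "\<dots> = 1 - (cos \<psi>)\<^sup>2" unfolding sin_cos_squared_add mult_1_right by (rule sin_squared_eq)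
      also have "\<dots> < 1\<^sup>2" using c by simp
      finally have z: "norm z < 1" by (rule power2_less_imp_less) simp
      have "quot_z ?k z = 1 / (of_real (cos \<psi>) * cis \<psi>)"
        unfolding quot_z_half_plane_map[OF z] by (simp add: z_def)
      also have "\<dots> = of_real (1 / cos \<psi>) * cis (- \<psi>)"
        by (simp add: divide_inverse cis_inverse)
      finally have "Arg (quot_z ?k z) = Arg (cis (- \<psi>))" using c by (simp only: Arg_times_of_real zero_less_divide_1_iff)
      also have "\<dots> = - \<psi>" using \<psi> pi_gt_zero by (intro cis_Arg_unique) auto
      finally have "\<psi> = \<bar>Arg (quot_z ?k z)\<bar>" using \<psi> by simp
      also have "\<dots> \<le> ?S ?k" using z by (intro cSUP_upper bdd_aboveI2[OF Arg_le[OF k]]) auto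
      also have "\<dots> \<le> ?T" by (intro cSUP_upper bdd_aboveI2[OF Sle] k)
      finally show ?thesis .
    qed
    show "pi/2 \<le> ?T"
    proof (rule dense_le_bounded[of 0])
      show "0 < pi/2" by simp
    qed (rule ge)
  qed
  thus ?thesis by (simp add: B_const_def)
qed

theorem theorem5p10:
  shows "strict_filtration {0..1} prestarlike \<and>
    (\<forall>\<alpha>\<in>{0<..1}. (\<lambda>z. z + 1 / (2 * (2 - of_real \<alpha>)) * z ^ 2)
       \<in> filtration_boundary {0..1} prestarlike \<alpha>) \<and>
    (\<forall>\<alpha>\<in>{0..1}. K_const (prestarlike \<alpha>) = 1 / 2 \<and> B_const (prestarlike \<alpha>) = 1)"
proof (intro conjI ballI)
  have "prestarlike s \<subseteq> class_G0" if "s \<in> {0..1}" for s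
  proof
    fix f assume "f \<in> prestarlike s"
    hence "f \<in> class_A" "\<forall>z\<in>ball 0 1. Re (quot_z f z) > 1/2"
      using prestarlike_Re_quot[of s f] that by (auto intro: prestarlike_Re_quot(1)[of s f 0])
    thus "f \<in> class_G0" unfolding class_G0_def by fastforce
  qed
  \<comment> \<open>The function that (b) attaches to t lies in R_t but not in R_s, so it separates
    the two classes.\<close>
  moreover have "prestarlike s \<subset> prestarlike t" if "s \<in> {0..1}" "t \<in> {0..1}" "s < t" for s t
    using prestarlike_mono[of s t] quadratic_in_prestarlike[of t] quadratic_notin_prestarlike[of s t] that by auto
  ultimately show "strict_filtration {0..1} prestarlike"
    using prestarlike_mono by (auto simp: strict_filtration_def filtration_def)
next
  fix \<alpha> :: real assume "\<alpha> \<in> {0<..1}"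
  thus "(\<lambda>z. z + 1 / (2 * (2 - of_real \<alpha>)) * z ^ 2) \<in> filtration_boundary {0..1} prestarlike \<alpha>"
    using quadratic_in_prestarlike[of \<alpha>] quadratic_notin_prestarlike[of _ \<alpha>]
    by (auto simp: filtration_boundary_def)
qed (use K_const_prestarlike B_const_prestarlike in auto)

end
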